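(* Let $S$ be a complete separable metric space, $(T,\mathcal T)$ a measurable space, $M\in\mathbb N$, $Z=(Z_1,\dots,Z_M)$ an $S^M$-valued random variable and $Y=(Y_1,\dots,Y_M)$ a $T^M$-valued random variable. Write $\boldsymbol Z_m=(Z_1,\dots,Z_m)$ and $\boldsymbol Y_m=(Y_1,\dots,Y_m)$. Assume there exist $\sigma$-finite measures $\mathfrak n_1,\mathfrak n_2,\dots,\mathfrak n_M$ on $S,S^2,\dots,S^M$ respectively, and a $\sigma$-finite measure $\widetilde{\mathfrak n}$ on $T$, such that $\mathcal L(Y,\boldsymbol Z_m)\ll\widetilde{\mathfrak n}^M\times\mathfrak n_m$ for every $m\in\{1,\dots,M\}$. Let $f_m$ be the density of $(Y,\boldsymbol Z_m)$ with respect to $\widetilde{\mathfrak n}^M\times\mathfrak n_m$, and for $(y,z)\in T^M\times S^M$ define $$w(y,z)=f_1(y_1)\prod_{m=1}^{M-1}f_m(y_{m+1}\mid\boldsymbol y_m,\boldsymbol z_m).$$ Let $\mathfrak m^*$ be the simulation measure defined in the context, let $Z^{*,1},Z^{*,2},\dots$ be $S^M$-valued random variables that are i.i.d. given $Y$ with conditional law $\mathfrak m^*(Y)$, let $W_k=w(Y,Z^{*,k})$, and for $K\in\mathbb N$ let $\widetilde Z^K$ be a random variable with $$\mathcal L(\widetilde Z^K\mid Z^{*,1},\dots,Z^{*,K},Y)=\frac{\sum_{k=1}^K W_k\,\delta_{Z^{*,k}}}{\sum_{k=1}^K W_k}$$ (on the event that the denominator is positive; arbitrary otherwise). If $f_M(y)\in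 L^2(\widetilde{\mathfrak n}^M)$, then, almost surely, as $K\to\infty$, $$\mathcal L(\widetilde Z^K\mid Z^{*,1},\dots,Z^{*,K},Y)\to\mathcal L(Z\mid Y)$$ in the sense of weak convergence of Borel probability measures on $S^M$.
   Context: $\mathcal L(X\mid Y)$ denotes the regular conditional distribution of $X$ given $Y$. For $y\in T^M$ and $z\in S^M$, write $\boldsymbol y_m=(y_1,\dots,y_m)$, $\boldsymbol z_m=(z_1,\dots,z_m)$; variables with subscript $0$ are omitted. Simulation measure: for $1\le m\le M$ let $\gamma_m$ be a probability kernel from $T^m\times S^{m-1}$ to $S$ with $\mathcal L(Z_m\mid\boldsymbol Y_m,\boldsymbol Z_{m-1})=\gamma_m(\boldsymbol Y_m,\boldsymbol Z_{m-1})$ a.s., and let $\gamma_m^*(y,\boldsymbol z_{m-1})=\gamma_m(\boldsymbol y_m,\boldsymbol z_{m-1})$, a kernel from $T^M\times S^{m-1}$ to $S$. Then $\mathfrak m^*=\gamma_1^*\cdots\gamma_M^*$ is the probability kernel from $T^M$ to $S^M$ given by $$\mathfrak m^*(y,dz)=\gamma_M(\boldsymbol y_M,\boldsymbol z_{M-1},dz_M)\cdots\gamma_2(\boldsymbol y_2,z_1,dz_2)\,\gamma_1(y_1,dz_1);$$ that is, under $\mathfrak m^*(y)$ the coordinates are generated sequentially, the $m$th having conditional law $\gamma_m(\boldsymbol y_m,\boldsymbol z_{m-1})$ given the first $m-1$. Density conventions: writing $f_m$ with some arguments omitted means the marginal density obtained by integrating those arguments out (with respect to the corresponding reference measure); e.g.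 $f_m(\boldsymbol y_k,\boldsymbol z_m)=\int_{T^{M-k}}f_m(y,\boldsymbol z_m)\,\widetilde{\mathfrak n}^{M-k}(dy_{k+1}\cdots dy_M)$, and $f_m(\boldsymbol y_k)$ also integrates out $\boldsymbol z_m$ against $\mathfrak n_m$. In particular $f_M(y)$ is the marginal density of $Y$ with respect to $\widetilde{\mathfrak n}^M$. The version of $f_m$ is chosen with values in $[0,\infty)$ and so that whenever a marginal density vanishes at a point, $f_m$ vanishes there for all values of the omitted arguments. Conditional densities are ratios of marginals: $f_m(y_{m+1}\mid\boldsymbol y_m,\boldsymbol z_m)=f_m(\boldsymbol y_{m+1},\boldsymbol z_m)/f_m(\boldsymbol y_m,\boldsymbol z_m)$, with $0/0=0$. *)

theory Defs
  imports "HOL-Probability.Probability"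
begin

(* Vectors (x_1,...,x_m) are functions on {1..m}, undefined elsewhere (the PiM convention).
   For m = 0 the space has a single point, so arguments with subscript 0 carry no information. *)
abbreviation vec_measure :: "'a measure \<Rightarrow> nat \<Rightarrow> (nat \<Rightarrow> 'a) measure" where
  "vec_measure N m \<equiv> PiM {1..m} (\<lambda>_. N)"

text \<open>\<^term>\<open>\<kappa>\<close> is a regular version of the conditional distribution of \<^term>\<open>X\<close> (with values in
  \<^term>\<open>N\<close>) given \<^term>\<open>Y\<close> (with values in \<^term>\<open>L\<close>). Versions are not unique;
  two of them give the same measure at \<open>Y \<omega>\<close> only almost surely (if \<^term>\<open>N\<close> is countably generated).\<close>
definition reg_cond_dist ::
  "'w measure \<Rightarrow> ('w \<Rightarrow> 'x) \<Rightarrow> 'x measure \<Rightarrow> ('w \<Rightarrow> 'y) \<Rightarrow> 'y measure \<Rightarrow> ('y \<Rightarrow> 'x measure) \<Rightarrow> bool" where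
  "reg_cond_dist P X N Y L \<kappa> \<longleftrightarrow>
     X \<in> measurable P N \<and> Y \<in> measurable P L \<and> \<kappa> \<in> measurable L (prob_algebra N) \<and>
     (\<forall>A\<in>sets N. AE \<omega> in P.
        measure (\<kappa> (Y \<omega>)) A =
        real_cond_exp P (vimage_algebra (space P) Y L) (indicator (X -` A \<inter> space P)) \<omega>)"

text \<open>\<open>X 1, X 2, \<dots>\<close> are i.i.d. given \<^term>\<open>Y\<close> with conditional law \<^term>\<open>\<kappa> (Y \<omega>)\<close>
  (\<open>X 0\<close> is not used): conditional joint probabilities factorize.\<close>
definition cond_iid ::
  "'w measure \<Rightarrow> (nat \<Rightarrow> 'w \<Rightarrow> 'x) \<Rightarrow> 'x measure \<Rightarrow> ('w \<Rightarrow> 'y) \<Rightarrow> 'y measure \<Rightarrow> ('y \<Rightarrow> 'x measure) \<Rightarrow> bool" where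
  "cond_iid P X N Y L \<kappa> \<longleftrightarrow>
     (\<forall>k\<ge>1. X k \<in> measurable P N) \<and> Y \<in> measurable P L \<and> \<kappa> \<in> measurable L (prob_algebra N) \<and>
     (\<forall>K A. (\<forall>k\<in>{1..K}. A k \<in> sets N) \<longrightarrow>
        (AE \<omega> in P.
          real_cond_exp P (vimage_algebra (space P) Y L)
            (indicator {\<omega> \<in> space P. \<forall>k\<in>{1..K}. X k \<omega> \<in> A k}) \<omega>
          = (\<Prod>k=1..K. measure (\<kappa> (Y \<omega>)) (A k))))"

text \<open>The law of the first \<open>m\<close> coordinates under \<open>\<gamma>\<^sub>1\<^sup>* \<cdots> \<gamma>\<^sub>M\<^sup>*\<close> at \<open>y\<close>; the simulation measure
  is the case \<open>m = M\<close>.\<close>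
primrec sim_measure ::
  "(nat \<Rightarrow> (nat \<Rightarrow> 't) \<times> (nat \<Rightarrow> 's) \<Rightarrow> 's measure) \<Rightarrow> nat \<Rightarrow> (nat \<Rightarrow> 't) \<Rightarrow> (nat \<Rightarrow> 's::topological_space) measure" where
  "sim_measure \<gamma> 0 y = return (vec_measure borel 0) (\<lambda>_. undefined)"
| "sim_measure \<gamma> (Suc m) y =
     sim_measure \<gamma> m y \<bind>
       (\<lambda>z. distr (\<gamma> (Suc m) (restrict y {1..Suc m}, z)) (vec_measure borel (Suc m)) (\<lambda>x. z(Suc m := x)))"

text \<open>Marginal densities of \<open>h(y, z)\<close>: \<open>marg_yz\<close> integrates out the coordinates of \<open>y\<close> outside
  \<open>J\<close> and keeps \<open>z\<close>; \<open>marg_y\<close> integrates out \<open>z\<close> as well. Marginals may take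
  the value \<open>\<infinity>\<close>, hence the type \<^typ>\<open>ennreal\<close>.\<close>
definition marg_yz ::
  "nat \<Rightarrow> 't measure \<Rightarrow> ((nat \<Rightarrow> 't) \<times> (nat \<Rightarrow> 's) \<Rightarrow> ennreal) \<Rightarrow> nat set \<Rightarrow> (nat \<Rightarrow> 't) \<Rightarrow> (nat \<Rightarrow> 's) \<Rightarrow> ennreal" where
  "marg_yz M NT h J y z =
     (\<integral>\<^sup>+u. h (merge J ({1..M} - J) (y, u), z) \<partial>PiM ({1..M} - J) (\<lambda>_. NT))"

definition marg_y ::
  "nat \<Rightarrow> 't measure \<Rightarrow> (nat \<Rightarrow> 's) measure \<Rightarrow> ((nat \<Rightarrow> 't) \<times> (nat \<Rightarrow> 's) \<Rightarrow> ennreal) \<Rightarrow> nat set \<Rightarrow> (nat \<Rightarrow> 't) \<Rightarrow> ennreal" where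
  "marg_y M NT N h J y = (\<integral>\<^sup>+z. marg_yz M NT h J y z \<partial>N)"

text \<open>The conditional density \<open>f\<^sub>m(y\<^sub>m\<^sub>+\<^sub>1 | y\<^sub>1, \<dots>, y\<^sub>m, z\<^sub>1, \<dots>, z\<^sub>m)\<close>.
  On \<^typ>\<open>ennreal\<close>, \<open>0 / 0 = 0\<close> as required.\<close>
definition cond_dens ::
  "nat \<Rightarrow> 't measure \<Rightarrow> (nat \<Rightarrow> (nat \<Rightarrow> 't) \<times> (nat \<Rightarrow> 's) \<Rightarrow> ennreal) \<Rightarrow> nat \<Rightarrow> (nat \<Rightarrow> 't) \<Rightarrow> (nat \<Rightarrow> 's) \<Rightarrow> ennreal" where
  "cond_dens M NT f m y z =
     marg_yz M NT (f m) {1..m+1} y (restrict z {1..m}) / marg_yz M NT (f m) {1..m} y (restrict z {1..m})"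

definition weight ::
  "nat \<Rightarrow> 't measure \<Rightarrow> (nat \<Rightarrow> (nat \<Rightarrow> 's) measure) \<Rightarrow> (nat \<Rightarrow> (nat \<Rightarrow> 't) \<times> (nat \<Rightarrow> 's) \<Rightarrow> ennreal)
     \<Rightarrow> (nat \<Rightarrow> 't) \<Rightarrow> (nat \<Rightarrow> 's) \<Rightarrow> ennreal" where
  "weight M NT n f y z = marg_y M NT (n 1) (f 1) {1..1} y * (\<Prod>m=1..<M. cond_dens M NT f m y z)"

text \<open>Weak convergence of measures on a topological space, tested on bounded continuous functions.
  It is used for the product topology on \<open>S\<^sup>M\<close>; as \<open>S\<close> is second countable, the Borel sets of that
  topology are the measurable sets of \<^term>\<open>vec_measure borel M\<close>.\<close>
definition weakly_converges :: "'x topology \<Rightarrow> (nat \<Rightarrow> 'x measure) \<Rightarrow> 'x measure \<Rightarrow> bool" where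
  "weakly_converges X \<mu> \<nu> \<longleftrightarrow>
     (\<forall>g. continuous_map X euclideanreal g \<and> bounded (g ` topspace X) \<longrightarrow>
        (\<lambda>K. \<integral>x. g x \<partial>\<mu> K) \<longlonglongrightarrow> (\<integral>x. g x \<partial>\<nu>))"

end

theory Submission
  imports Defs
begin

text \<open>
  For fixed \<open>y\<close> the weight \<open>w(y, \<cdot>)\<close> turns the simulation measure \<open>m\<^sup>*(y)\<close> into a multiple
  of the conditional law of \<open>Z\<close> given \<open>Y = y\<close>. Indeed, in \<open>w(y, z) m\<^sup>*(y, dz) NT\<^sup>M(dy)\<close>
  the kernel \<open>\<gamma>\<^sub>m\<close> supplies the conditional law of \<open>Z\<^sub>m\<close> given the preceding
  variables, the factor \<open>f\<^sub>m(y\<^sub>m\<^sub>+\<^sub>1 | \<dots>)\<close> supplies the conditional density of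
  \<open>Y\<^sub>m\<^sub>+\<^sub>1\<close>, and \<open>f\<^sub>1(y\<^sub>1)\<close> the density of \<open>Y\<^sub>1\<close>. Adding alternately one observation and one state gives the joint law of
  \<open>(Y, Z)\<close> (\<open>nn_integral_importance_sampling\<close>). Disintegration with respect to \<open>Y\<close>, whose
  density is \<open>f\<^sub>M(y)\<close>, then yields
  \<open>\<integral> w(y, z) h(z) m\<^sup>*(y, dz) = f\<^sub>M(y) E(h(Z) | Y = y)\<close> for every \<open>h \<ge> 0\<close> and almost every \<open>y\<close> (\<open>nn_integral_weight\<close>).

  Given \<open>Y\<close>, the simulated paths are i.i.d. with law \<open>m\<^sup>*(Y)\<close>. As \<open>f\<^sub>M(Y)\<close> is almost
  surely positive and finite, the weights have a finite conditional mean, and a conditional strong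
  law of large numbers (\<open>conditional_strong_law\<close>) applies: the averages of
  \<open>W\<^sub>k h(Z\<^sup>*\<^sup>,\<^sup>k)\<close> tend to \<open>f\<^sub>M(Y) E(h(Z) | Y)\<close> and those of \<open>W\<^sub>k\<close> to
  \<open>f\<^sub>M(Y)\<close>, so the self-normalized averages tend to \<open>E(h(Z) | Y)\<close>. The law of large numbers is
  proved under a first moment only (\<open>strong_law_of_large_numbers\<close>), since the identity above controls
  no higher moment of the weights.

  The exceptional null set still depends on \<open>h\<close>. It is removed by testing against countably many
  step functions which approximate every nonnegative continuous function from below
  (\<open>test_functions_approximate\<close>). For continuous \<open>g\<close> with \<open>\<bar>g\<bar> \<le> C\<close> this bounds the integrals of
  \<open>C + g\<close> and of \<open>C - g\<close> asymptotically from below, hence those of \<open>g\<close> from both sides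
  (\<open>weakly_converges_if_test_functions\<close>).
\<close>

section \<open>The strong law of large numbers under a product measure\<close>

text \<open>The maximum of \<open>0\<close> and the first \<open>n\<close> partial sums. The recursion peels off the first
  coordinate, so that the shift of the sequence appears explicitly.\<close>
primrec max_sum :: "('a \<Rightarrow> real) \<Rightarrow> nat \<Rightarrow> (nat \<Rightarrow> 'a) \<Rightarrow> real" where
  "max_sum h 0 \<omega> = 0"
| "max_sum h (Suc n) \<omega> = max 0 (h (\<omega> 0) + max_sum h n (\<lambda>k. \<omega> (Suc k)))"

lemma max_sum_nonneg: "0 \<le> max_sum h n \<omega>"
  by (cases n) auto

lemma max_sum_mono: "max_sum h n \<omega> \<le> max_sum h (Suc n) \<omega>"
proof (induction n arbitrary: \<omega>)
  case (Suc n)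
  show ?case using Suc[of "\<lambda>k. \<omega> (Suc k)"] by (simp del: max_sum.simps(2) add: max_sum.simps(2)[of h n \<omega>] max_sum.simps(2)[of h "Suc n" \<omega>])
qed simp

lemma sum_le_max_sum: "(\<Sum>k<n. h (\<omega> k)) \<le> max_sum h n \<omega>"
proof (induction n arbitrary: \<omega>)
  case (Suc n)
  have "(\<Sum>k<Suc n. h (\<omega> k)) = h (\<omega> 0) + (\<Sum>k<n. h (\<omega> (Suc k)))"
    by (rule sum.lessThan_Suc_shift)
  also have "\<dots> \<le> h (\<omega> 0) + max_sum h n (\<lambda>k. \<omega> (Suc k))"
    using Suc[of "\<lambda>k. \<omega> (Suc k)"] by simp
  finally show ?case by simp
qed simp

definition unbounded_sums :: "('a \<Rightarrow> real) \<Rightarrow> (nat \<Rightarrow> 'a) \<Rightarrow> bool" where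
  "unbounded_sums h \<omega> \<longleftrightarrow> (\<forall>b::nat. \<exists>n. real b < max_sum h n \<omega>)"

text \<open>Prepending \<open>x\<close> moves every maximal sum by at most \<open>\<bar>h x\<bar>\<close>, so the event is invariant under
  the shift. Under a product measure it is therefore independent of the first coordinate.\<close>
lemma unbounded_sums_shift:
  "unbounded_sums h (case_nat x \<omega>) \<longleftrightarrow> unbounded_sums h \<omega>"
proof
  assume L: "unbounded_sums h (case_nat x \<omega>)"
  show "unbounded_sums h \<omega>"
    unfolding unbounded_sums_def
  proof
    fix b :: nat
    obtain c :: nat where c: "b + \<bar>h x\<bar> < c" using reals_Archimedean2 by blast
    obtain n where n: "real c < max_sum h n (case_nat x \<omega>)"
      using L unfolding unbounded_sums_def by blast
    then obtain n' where "n = Suc n'" by (cases n) auto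
    with n c have "real b < max_sum h n' \<omega>" by auto
    then show "\<exists>n. real b < max_sum h n \<omega>" ..
  qed
next
  assume R: "unbounded_sums h \<omega>"
  show "unbounded_sums h (case_nat x \<omega>)"
    unfolding unbounded_sums_def
  proof
    fix b :: nat
    obtain c :: nat where c: "b + \<bar>h x\<bar> < c" using reals_Archimedean2 by blast
    obtain n where "real c < max_sum h n \<omega>"
      using R unfolding unbounded_sums_def by blast
    with c have "real b < max_sum h (Suc n) (case_nat x \<omega>)" by auto
    then show "\<exists>n. real b < max_sum h n (case_nat x \<omega>)" ..
  qed
qed

context sequence_space
begin

lemma measurable_max_sum [measurable]:
  assumes [measurable]: "h \<in> borel_measurable M"
  shows "max_sum h n \<in> borel_measurable S"
proof (induction n)
  case 0
  have "max_sum h 0 = (\<lambda>_. 0)" by (simp add: fun_eq_iff)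
  then show ?case by simp
next
  case (Suc n)
  have "(\<lambda>\<omega> k. \<omega> (Suc k)) \<in> S \<rightarrow>\<^sub>M S"
    by (rule measurable_PiM_single') (auto simp: space_PiM)
  note [measurable] = measurable_compose[OF this Suc]
  have "max_sum h (Suc n) = (\<lambda>\<omega>. max 0 (h (\<omega> 0) + max_sum h n (\<lambda>k. \<omega> (Suc k))))"
    by (simp add: fun_eq_iff)
  then show ?case by simp
qed

text \<open>Under the product measure, a first coordinate and an independent sequence combine to a sequence
  with the same law.\<close>
lemma
  fixes f :: "(nat \<Rightarrow> 'a) \<Rightarrow> real"
  assumes f [measurable]: "f \<in> borel_measurable S"
  shows integral_iter: "(\<integral>\<omega>. f \<omega> \<partial>S) = (\<integral>(x, \<omega>). f (case_nat x \<omega>) \<partial>(M \<Otimes>\<^sub>M S))"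
    and integrable_iter: "integrable S f \<longleftrightarrow> integrable (M \<Otimes>\<^sub>M S) (\<lambda>(x, \<omega>). f (case_nat x \<omega>))"
proof -
  have [measurable]: "(\<lambda>(x, \<omega>). case_nat x \<omega>) \<in> M \<Otimes>\<^sub>M S \<rightarrow>\<^sub>M S"
    by measurable
  show "(\<integral>\<omega>. f \<omega> \<partial>S) = (\<integral>(x, \<omega>). f (case_nat x \<omega>) \<partial>(M \<Otimes>\<^sub>M S))"
    by (subst PiM_iter[symmetric], subst integral_distr) (auto simp: case_prod_beta')
  show "integrable S f \<longleftrightarrow> integrable (M \<Otimes>\<^sub>M S) (\<lambda>(x, \<omega>). f (case_nat x \<omega>))"
    by (subst PiM_iter[symmetric], subst integrable_distr_eq) (auto simp: case_prod_beta')
qed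

lemma prob_pair_S: "pair_prob_space M S"
  by (intro pair_prob_space.intro pair_sigma_finite.intro) unfold_locales


text \<open>On the shift-invariant event \<open>A\<close> that the maximal sums \<open>M\<^sub>n\<close> are unbounded, consider
  \<open>M\<^sub>n\<^sub>+\<^sub>1(x, \<omega>) - M\<^sub>n(\<omega>) = max (- M\<^sub>n(\<omega>)) (h x)\<close>. Its integral over \<open>A\<close> is nonnegative,
  because \<open>M\<^sub>n\<close> increases with \<open>n\<close> and the shift preserves the measure. The difference is
  dominated by \<open>\<bar>h x\<bar>\<close> and tends to \<open>h x\<close> on \<open>A\<close>; in the limit \<open>0 \<le> E h \<cdot> P(A)\<close>, so
  \<open>P(A) = 0\<close> if \<open>E h\<close> is negative.\<close>
lemma AE_bounded_sums:
  fixes h :: "'a \<Rightarrow> real"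
  assumes h: "integrable M h" and neg: "(\<integral>x. h x \<partial>M) < 0"
  shows "AE \<omega> in S. \<not> unbounded_sums h \<omega>"
proof -
  interpret Q: pair_prob_space M S by (rule prob_pair_S)
  have [measurable]: "h \<in> borel_measurable M" using h by auto
  have [measurable]: "Measurable.pred S (unbounded_sums h)"
    unfolding unbounded_sums_def by measurable
  let ?I = "\<lambda>\<omega>. indicator {\<omega>. unbounded_sums h \<omega>} \<omega> :: real"
  have [measurable]: "?I \<in> borel_measurable S"
    by (subst indicator_def) measurable
  have hI: "integrable (M \<Otimes>\<^sub>M S) (\<lambda>(x, \<omega>). h x * ?I \<omega>)"
  proof (rule Q.Fubini_integrable)
    show "integrable M (\<lambda>x. \<integral>\<omega>. norm (case (x, \<omega>) of (x, \<omega>) \<Rightarrow> h x * ?I \<omega>) \<partial>S)"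
      using h by (simp add: abs_mult)
    show "AE x in M. integrable S (\<lambda>\<omega>. case (x, \<omega>) of (x, \<omega>) \<Rightarrow> h x * ?I \<omega>)"
      by (auto intro!: P.integrable_const_bound[where B=1])
  qed measurable
  have habs: "integrable (M \<Otimes>\<^sub>M S) (\<lambda>(x, \<omega>). \<bar>h x\<bar>)"
    by (rule Q.Fubini_integrable) (use h in auto)
  have int: "integrable S (max_sum h n)" for n
  proof (induction n)
    case 0
    have "max_sum h 0 = (\<lambda>_. 0)" by (simp add: fun_eq_iff)
    then show ?case by simp
  next
    case (Suc n)
    have "integrable (M \<Otimes>\<^sub>M S) (\<lambda>(x, \<omega>). \<bar>max_sum h n \<omega>\<bar>)"
      by (rule Q.Fubini_integrable) (use Suc in auto)
    with habs have "integrable (M \<Otimes>\<^sub>M S) (\<lambda>p. \<bar>h (fst p)\<bar> + \<bar>max_sum h n (snd p)\<bar>)"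
      by (auto simp: case_prod_beta')
    then show ?case
      unfolding integrable_iter[OF measurable_max_sum[OF \<open>h \<in> borel_measurable M\<close>]]
      by (rule Bochner_Integration.integrable_bound) (auto simp: case_prod_beta')
  qed
  have nonneg: "0 \<le> (\<integral>(x, \<omega>). max (- max_sum h n \<omega>) (h x) * ?I \<omega> \<partial>(M \<Otimes>\<^sub>M S))" for n
  proof -
    have i1: "integrable S (\<lambda>\<omega>. max_sum h n \<omega> * ?I \<omega>)" for n
      by (rule Bochner_Integration.integrable_bound[OF int[of n]])
         (auto simp: abs_mult indicator_def)
    have i2: "integrable (M \<Otimes>\<^sub>M S) (\<lambda>(x, \<omega>). max_sum h (Suc n) (case_nat x \<omega>) * ?I (case_nat x \<omega>))"
      using i1[of "Suc n"] by (subst (asm) integrable_iter) measurable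
    have i3: "integrable (M \<Otimes>\<^sub>M S) (\<lambda>(x, \<omega>). max_sum h n \<omega> * ?I \<omega>)"
      by (rule Q.Fubini_integrable) (use i1[of n] in \<open>auto simp: abs_mult max_sum_nonneg\<close>)
    have "(\<integral>\<omega>. max_sum h n \<omega> * ?I \<omega> \<partial>S) \<le> (\<integral>\<omega>. max_sum h (Suc n) \<omega> * ?I \<omega> \<partial>S)"
      by (intro integral_mono i1 mult_right_mono max_sum_mono) auto
    also have "\<dots> = (\<integral>(x, \<omega>). max_sum h (Suc n) (case_nat x \<omega>) * ?I (case_nat x \<omega>) \<partial>(M \<Otimes>\<^sub>M S))"
      by (rule integral_iter[where f="\<lambda>\<omega>. max_sum h (Suc n) \<omega> * ?I \<omega>"]) measurable
    finally have "(\<integral>(x, \<omega>). max_sum h n \<omega> * ?I \<omega> \<partial>(M \<Otimes>\<^sub>M S))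
        \<le> (\<integral>(x, \<omega>). max_sum h (Suc n) (case_nat x \<omega>) * ?I (case_nat x \<omega>) \<partial>(M \<Otimes>\<^sub>M S))"
      using Q.integral_fst'[OF i3] by (simp add: M.prob_space del: max_sum.simps)
    then have "0 \<le> (\<integral>p. (case p of (x, \<omega>) \<Rightarrow> max_sum h (Suc n) (case_nat x \<omega>) * ?I (case_nat x \<omega>))
        - (case p of (x, \<omega>) \<Rightarrow> max_sum h n \<omega> * ?I \<omega>) \<partial>(M \<Otimes>\<^sub>M S))"
      by (subst Bochner_Integration.integral_diff[OF i2 i3]) simp
    also have "\<dots> = (\<integral>(x, \<omega>). max (- max_sum h n \<omega>) (h x) * ?I \<omega> \<partial>(M \<Otimes>\<^sub>M S))"
      by (rule Bochner_Integration.integral_cong)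
         (auto simp: unbounded_sums_shift indicator_def max_def)
    finally show ?thesis .
  qed
  have "(\<lambda>n. \<integral>(x, \<omega>). max (- max_sum h n \<omega>) (h x) * ?I \<omega> \<partial>(M \<Otimes>\<^sub>M S))
      \<longlonglongrightarrow> (\<integral>(x, \<omega>). h x * ?I \<omega> \<partial>(M \<Otimes>\<^sub>M S))"
  proof (rule integral_dominated_convergence[OF _ _ habs])
    show "AE p in M \<Otimes>\<^sub>M S. (\<lambda>n. case p of (x, \<omega>) \<Rightarrow> max (- max_sum h n \<omega>) (h x) * ?I \<omega>)
        \<longlonglongrightarrow> (case p of (x, \<omega>) \<Rightarrow> h x * ?I \<omega>)"
    proof (rule AE_I2, clarify)
      fix x \<omega>
      show "(\<lambda>n. max (- max_sum h n \<omega>) (h x) * ?I \<omega>) \<longlonglongrightarrow> h x * ?I \<omega>"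
      proof (cases "unbounded_sums h \<omega>")
        case True
        obtain c :: nat where c: "\<bar>h x\<bar> < c" using reals_Archimedean2 by blast
        obtain N where N: "real c < max_sum h N \<omega>"
          using True unfolding unbounded_sums_def by blast
        have "max (- max_sum h n \<omega>) (h x) = h x" if "n \<ge> N" for n
        proof -
          have "max_sum h N \<omega> \<le> max_sum h n \<omega>"
            by (rule lift_Suc_mono_le[of "\<lambda>n. max_sum h n \<omega>", OF max_sum_mono that])
          with N c show ?thesis by auto
        qed
        then have "eventually (\<lambda>n. max (- max_sum h n \<omega>) (h x) * ?I \<omega> = h x * ?I \<omega>) sequentially"
          unfolding eventually_sequentially by auto
        then show ?thesis by (rule tendsto_eventually)
      qed simp
    qed
    show "AE p in M \<Otimes>\<^sub>M S. norm (case p of (x, \<omega>) \<Rightarrow> max (- max_sum h n \<omega>) (h x) * ?I \<omega>)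
        \<le> (case p of (x, \<omega>) \<Rightarrow> \<bar>h x\<bar>)" for n
    proof (rule AE_I2, clarify)
      fix x \<omega>
      show "norm (max (- max_sum h n \<omega>) (h x) * ?I \<omega>) \<le> \<bar>h x\<bar>"
        using max_sum_nonneg[of h n \<omega>] by (auto simp: indicator_def max_def)
    qed
  qed measurable
  then have "0 \<le> (\<integral>(x, \<omega>). h x * ?I \<omega> \<partial>(M \<Otimes>\<^sub>M S))"
    by (rule LIMSEQ_le_const) (use nonneg in auto)
  also have "\<dots> = (\<integral>x. h x \<partial>M) * (\<integral>\<omega>. ?I \<omega> \<partial>S)"
    by (subst Q.integral_fst'[OF hI, symmetric]) simp
  finally have "(\<integral>\<omega>. ?I \<omega> \<partial>S) \<le> 0"
    using neg by (simp add: zero_le_mult_iff)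
  moreover have "0 \<le> (\<integral>\<omega>. ?I \<omega> \<partial>S)" by simp
  moreover have "integrable S ?I"
    by (rule P.integrable_const_bound[where B=1]) auto
  ultimately have "AE \<omega> in S. ?I \<omega> = 0"
    by (subst integral_nonneg_eq_0_iff_AE[symmetric]) (auto intro!: antisym)
  then show ?thesis
    by eventually_elim (auto simp: indicator_def)
qed

text \<open>For \<open>d\<close> strictly between the mean of \<open>g\<close> and \<open>c\<close>, the sums of \<open>g - d\<close> stay bounded above;
  dividing by \<open>n\<close> makes that bound negligible against \<open>c - d\<close>.\<close>
lemma AE_eventually_mean_less:
  fixes g :: "'a \<Rightarrow> real"
  assumes g: "integrable M g" and c: "(\<integral>x. g x \<partial>M) < c"
  shows "AE \<omega> in S. eventually (\<lambda>n. (\<Sum>k<n. g (\<omega> k)) / n < c) sequentially"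
proof -
  obtain d where d: "(\<integral>x. g x \<partial>M) < d" "d < c" using dense[OF c] by auto
  have "AE \<omega> in S. \<not> unbounded_sums (\<lambda>x. g x - d) \<omega>"
    by (rule AE_bounded_sums) (use g d in \<open>auto simp: M.prob_space\<close>)
  then show ?thesis
  proof eventually_elim
    case (elim \<omega>)
    then obtain b :: nat where b: "\<And>n. max_sum (\<lambda>x. g x - d) n \<omega> \<le> b"
      unfolding unbounded_sums_def by (meson not_less)
    have le: "(\<Sum>k<n. g (\<omega> k)) \<le> n * d + b" for n
      using sum_le_max_sum[where h="\<lambda>x. g x - d" and \<omega>=\<omega> and n=n] b[of n]
      by (simp add: sum_subtractf)
    obtain N :: nat where N: "b / (c - d) < N" using reals_Archimedean2 by blast
    have "(\<Sum>k<n. g (\<omega> k)) / n < c" if "n \<ge> Suc N" for n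
    proof -
      have "b / (c - d) < n" using N that by linarith
      then have "b < n * (c - d)" using d by (simp add: field_simps)
      then have "(\<Sum>k<n. g (\<omega> k)) < c * n"
        using le[of n] by (simp add: algebra_simps)
      then show ?thesis using that by (simp add: divide_less_eq)
    qed
    then show ?case unfolding eventually_sequentially by blast
  qed
qed

text \<open>The one-sided bound, applied to \<open>g\<close> and to \<open>- g\<close>, encloses the averages.\<close>
theorem strong_law_of_large_numbers:
  fixes g :: "'a \<Rightarrow> real"
  assumes g: "integrable M g"
  shows "AE \<omega> in S. (\<lambda>n. (\<Sum>k<n. g (\<omega> k)) / n) \<longlonglongrightarrow> (\<integral>x. g x \<partial>M)"
proof -
  let ?\<mu> = "\<integral>x. g x \<partial>M"
  have up: "AE \<omega> in S. \<forall>j::nat. eventually (\<lambda>n. (\<Sum>k<n. g (\<omega> k)) / n < ?\<mu> + 1 / Suc j) sequentially"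
    unfolding AE_all_countable by (intro allI AE_eventually_mean_less g) simp
  have lo: "AE \<omega> in S. \<forall>j::nat. eventually (\<lambda>n. (\<Sum>k<n. - g (\<omega> k)) / n < - ?\<mu> + 1 / Suc j) sequentially"
    unfolding AE_all_countable by (intro allI AE_eventually_mean_less) (use g in auto)
  from up lo show ?thesis
  proof eventually_elim
    case (elim \<omega>)
    show ?case
    proof (rule tendstoI)
      fix e :: real assume "0 < e"
      then obtain j where j: "1 / Suc j < e" using nat_approx_posE by metis
      from elim(1)[rule_format, of j] elim(2)[rule_format, of j]
      show "eventually (\<lambda>n. dist ((\<Sum>k<n. g (\<omega> k)) / n) ?\<mu> < e) sequentially"
      proof eventually_elim
        case (elim n)
        with j show ?case by (simp add: dist_real_def sum_negf abs_less_iff)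
      qed
    qed
  qed
qed

end

section \<open>Joint laws from conditional laws\<close>

lemma prob_algebra_kernel:
  assumes "\<kappa> \<in> L \<rightarrow>\<^sub>M prob_algebra N" "y \<in> space L"
  shows "prob_space (\<kappa> y)" "sets (\<kappa> y) = sets N" "space (\<kappa> y) = space N"
  using measurable_space[OF assms] by (auto simp: space_prob_algebra dest: sets_eq_imp_space_eq)

lemma sigma_finite_subalgebra_vimage:
  assumes "prob_space P" and Y: "Y \<in> P \<rightarrow>\<^sub>M L"
  shows "sigma_finite_subalgebra P (vimage_algebra (space P) Y L)"
proof -
  interpret prob_space P by fact
  have sub: "subalgebra P (vimage_algebra (space P) Y L)"
    unfolding subalgebra_def using measurable_space[OF Y] measurable_sets[OF Y]
    by (auto simp: sets_vimage_algebra2)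
  interpret R: finite_measure "restr_to_subalg P (vimage_algebra (space P) Y L)"
    by (rule finite_measure_restr_to_subalg[OF sub]) unfold_locales
  show ?thesis
    by (intro sigma_finite_subalgebra.intro sub) unfold_locales
qed

text \<open>By definition, the conditional probability of \<open>X \<in> A\<close> integrates over \<open>Y \<in> B\<close> to the
  probability of both events; this turns an almost sure statement about \<open>real_cond_exp\<close> into one about the joint law.\<close>
lemma emeasure_rectangle_of_cond_prob:
  assumes "prob_space P" and X [measurable]: "X \<in> P \<rightarrow>\<^sub>M N" and Y [measurable]: "Y \<in> P \<rightarrow>\<^sub>M L"
    and \<kappa> [measurable]: "\<kappa> \<in> L \<rightarrow>\<^sub>M prob_algebra N"
    and A [measurable]: "A \<in> sets N" and B [measurable]: "B \<in> sets L"
    and cond: "AE \<omega> in P. measure (\<kappa> (Y \<omega>)) A =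
      real_cond_exp P (vimage_algebra (space P) Y L) (indicator (X -` A \<inter> space P)) \<omega>"
  shows "emeasure P {\<omega> \<in> space P. Y \<omega> \<in> B \<and> X \<omega> \<in> A}
    = (\<integral>\<^sup>+\<omega>. emeasure (\<kappa> (Y \<omega>)) A * indicator B (Y \<omega>) \<partial>P)"
proof -
  interpret prob_space P by fact
  let ?F = "vimage_algebra (space P) Y L"
  interpret sigma_finite_subalgebra P ?F
    using assms(1) Y by (rule sigma_finite_subalgebra_vimage)
  have [measurable]: "(\<lambda>y. measure (\<kappa> y) A) \<in> borel_measurable L"
    by (rule measurable_compose[OF measurable_prob_algebraD[OF \<kappa>]]) measurable
  have Y': "Y \<omega> \<in> space L" if "\<omega> \<in> space P" for \<omega>
    using measurable_space[OF Y that] .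
  have le1: "measure (\<kappa> (Y \<omega>)) A \<le> 1" if "\<omega> \<in> space P" for \<omega>
    using prob_algebra_kernel(1)[OF \<kappa> Y'[OF that]] by (rule prob_space.prob_le_1)
  have em: "emeasure (\<kappa> (Y \<omega>)) A = ennreal (measure (\<kappa> (Y \<omega>)) A)" if "\<omega> \<in> space P" for \<omega>
  proof -
    interpret K: prob_space "\<kappa> (Y \<omega>)"
      using prob_algebra_kernel(1)[OF \<kappa> Y'[OF that]] .
    show ?thesis by (rule K.emeasure_eq_measure)
  qed
  let ?B = "Y -` B \<inter> space P"
  have XA: "X -` A \<inter> space P \<in> sets P" and YB: "?B \<in> sets P" by measurable
  have intA: "integrable P (indicator (X -` A \<inter> space P) :: _ \<Rightarrow> real)"
    using XA by (simp add: emeasure_eq_measure)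
  have "prob {\<omega> \<in> space P. Y \<omega> \<in> B \<and> X \<omega> \<in> A} = prob ((X -` A \<inter> space P) \<inter> ?B)"
    by (rule arg_cong[where f=prob]) auto
  also have "\<dots> = (\<integral>\<omega>. indicator ((X -` A \<inter> space P) \<inter> ?B) \<omega> \<partial>P)"
    using XA YB by simp
  also have "\<dots> = (\<integral>\<omega>\<in>?B. indicator (X -` A \<inter> space P) \<omega> \<partial>P)"
    unfolding set_lebesgue_integral_def
    by (rule Bochner_Integration.integral_cong) (auto simp: indicator_def)
  also have "\<dots> = (\<integral>\<omega>\<in>?B. real_cond_exp P ?F (indicator (X -` A \<inter> space P)) \<omega> \<partial>P)"
    by (rule real_cond_exp_intA[OF intA]) (auto intro: in_vimage_algebra)
  also have "\<dots> = (\<integral>\<omega>. measure (\<kappa> (Y \<omega>)) A * indicator B (Y \<omega>) \<partial>P)"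
    unfolding set_lebesgue_integral_def
  proof (rule integral_cong_AE)
    show "AE \<omega> in P. indicator ?B \<omega> *\<^sub>R real_cond_exp P ?F (indicator (X -` A \<inter> space P)) \<omega>
        = measure (\<kappa> (Y \<omega>)) A * indicator B (Y \<omega>)"
      using cond AE_space by eventually_elim (auto simp: indicator_def)
  qed (use YB in measurable)
  finally have "emeasure P {\<omega> \<in> space P. Y \<omega> \<in> B \<and> X \<omega> \<in> A}
      = ennreal (\<integral>\<omega>. measure (\<kappa> (Y \<omega>)) A * indicator B (Y \<omega>) \<partial>P)"
    by (simp add: emeasure_eq_measure)
  also have "\<dots> = (\<integral>\<^sup>+\<omega>. ennreal (measure (\<kappa> (Y \<omega>)) A * indicator B (Y \<omega>)) \<partial>P)"
  proof (rule nn_integral_eq_integral[symmetric])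
    show "integrable P (\<lambda>\<omega>. measure (\<kappa> (Y \<omega>)) A * indicator B (Y \<omega>))"
      by (rule integrable_const_bound[where B=1])
         (use le1 AE_space in \<open>auto simp: indicator_def\<close>)
  qed auto
  also have "\<dots> = (\<integral>\<^sup>+\<omega>. emeasure (\<kappa> (Y \<omega>)) A * indicator B (Y \<omega>) \<partial>P)"
    by (rule nn_integral_cong) (auto simp: em indicator_def)
  finally show ?thesis .
qed

text \<open>The law of a pair whose first component has law \<open>\<mu>\<close> and whose second component, given that the
  first one is \<open>y\<close>, has law \<open>\<kappa> y\<close>.\<close>
definition kernel_prod :: "'y measure \<Rightarrow> 'x measure \<Rightarrow> ('y \<Rightarrow> 'x measure) \<Rightarrow> ('y \<times> 'x) measure" where
  "kernel_prod \<mu> N \<kappa> = \<mu> \<bind> (\<lambda>y. distr (\<kappa> y) (\<mu> \<Otimes>\<^sub>M N) (Pair y))"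

lemma kernel_prod_kernel [measurable]:
  assumes [measurable]: "\<kappa> \<in> \<mu> \<rightarrow>\<^sub>M prob_algebra N"
  shows "(\<lambda>y. distr (\<kappa> y) (\<mu> \<Otimes>\<^sub>M N) (Pair y)) \<in> \<mu> \<rightarrow>\<^sub>M subprob_algebra (\<mu> \<Otimes>\<^sub>M N)"
  by (rule measurable_prob_algebraD, rule measurable_distr_prob_space2[OF assms]) measurable

lemma sets_kernel_prod:
  assumes "\<kappa> \<in> \<mu> \<rightarrow>\<^sub>M prob_algebra N" "space \<mu> \<noteq> {}"
  shows "sets (kernel_prod \<mu> N \<kappa>) = sets (\<mu> \<Otimes>\<^sub>M N)"
  unfolding kernel_prod_def
  by (rule sets_bind[OF _ assms(2)]) auto

lemma nn_integral_kernel_prod: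
  assumes [measurable]: "\<kappa> \<in> \<mu> \<rightarrow>\<^sub>M prob_algebra N" "F \<in> borel_measurable (\<mu> \<Otimes>\<^sub>M N)"
  shows "(\<integral>\<^sup>+p. F p \<partial>kernel_prod \<mu> N \<kappa>) = (\<integral>\<^sup>+y. \<integral>\<^sup>+x. F (y, x) \<partial>\<kappa> y \<partial>\<mu>)"
  unfolding kernel_prod_def
proof (subst nn_integral_bind[OF assms(2) kernel_prod_kernel[OF assms(1)]], rule nn_integral_cong)
  fix y assume y: "y \<in> space \<mu>"
  have "Pair y \<in> \<kappa> y \<rightarrow>\<^sub>M \<mu> \<Otimes>\<^sub>M N"
    using y prob_algebra_kernel(2)[OF assms(1) y] by (simp cong: measurable_cong_sets)
  then show "(\<integral>\<^sup>+p. F p \<partial>distr (\<kappa> y) (\<mu> \<Otimes>\<^sub>M N) (Pair y)) = (\<integral>\<^sup>+x. F (y, x) \<partial>\<kappa> y)"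
    by (simp add: nn_integral_distr)
qed

text \<open>Conditional probabilities of the sets in an intersection-stable generator already determine the
  joint law, by uniqueness of measures. The generator is a parameter because a regular conditional
  distribution prescribes all measurable sets, whereas \<open>cond_iid\<close> prescribes only finite-dimensional
  cylinders.\<close>
lemma joint_law:
  assumes P: "prob_space P" and X [measurable]: "X \<in> P \<rightarrow>\<^sub>M N" and Y [measurable]: "Y \<in> P \<rightarrow>\<^sub>M L"
    and \<kappa> [measurable]: "\<kappa> \<in> L \<rightarrow>\<^sub>M prob_algebra N"
    and G: "Int_stable G" "G \<subseteq> Pow (space N)" "sets N = sigma_sets (space N) G" "space N \<in> G"
    and cond: "\<And>A. A \<in> G \<Longrightarrow> AE \<omega> in P. measure (\<kappa> (Y \<omega>)) A =
      real_cond_exp P (vimage_algebra (space P) Y L) (indicator (X -` A \<inter> space P)) \<omega>"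
  shows "distr P (L \<Otimes>\<^sub>M N) (\<lambda>\<omega>. (Y \<omega>, X \<omega>)) = kernel_prod (distr P L Y) N \<kappa>"
proof -
  interpret prob_space P by fact
  have ne: "space (distr P L Y) \<noteq> {}"
    using not_empty measurable_space[OF Y] by auto
  have \<kappa>': "\<kappa> \<in> distr P L Y \<rightarrow>\<^sub>M prob_algebra N" by simp
  have sets_pair: "sets (L \<Otimes>\<^sub>M N) = sigma_sets (space L \<times> space N) {a \<times> b |a b. a \<in> sets L \<and> b \<in> G}"
  proof (subst sets_pair_eq[of "sets L" L "{space L}" G N "{space N}"])
    show "sets (sigma (space L \<times> space N) {a \<times> b |a b. a \<in> sets L \<and> b \<in> G})
      = sigma_sets (space L \<times> space N) {a \<times> b |a b. a \<in> sets L \<and> b \<in> G}"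
      using G(2) sets.space_closed[of L] by (intro sets_measure_of) blast
  qed (use G sets.space_closed[of L] sets.sigma_sets_eq[of L] in auto)
  show ?thesis
  proof (rule measure_eqI_generator_eq)
    show "Int_stable {a \<times> b |a b. a \<in> sets L \<and> b \<in> G}"
    proof (rule Int_stableI)
      fix U V assume "U \<in> {a \<times> b |a b. a \<in> sets L \<and> b \<in> G}" "V \<in> {a \<times> b |a b. a \<in> sets L \<and> b \<in> G}"
      then obtain a b c d where *: "U = a \<times> b" "V = c \<times> d"
        and ac: "a \<in> sets L" "c \<in> sets L" and bd: "b \<in> G" "d \<in> G" by auto
      have "b \<inter> d \<in> G" using G(1) bd by (auto simp: Int_stable_def)
      moreover have "a \<inter> c \<in> sets L" using ac by simp
      moreover have "U \<inter> V = (a \<inter> c) \<times> (b \<inter> d)" using * by auto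
      ultimately show "U \<inter> V \<in> {a \<times> b |a b. a \<in> sets L \<and> b \<in> G}" by blast
    qed
    show "{a \<times> b |a b. a \<in> sets L \<and> b \<in> G} \<subseteq> Pow (space L \<times> space N)"
      using G(2) sets.space_closed[of L] by blast
    show "sets (distr P (L \<Otimes>\<^sub>M N) (\<lambda>\<omega>. (Y \<omega>, X \<omega>)))
        = sigma_sets (space L \<times> space N) {a \<times> b |a b. a \<in> sets L \<and> b \<in> G}"
      by (simp add: sets_pair)
    show "sets (kernel_prod (distr P L Y) N \<kappa>)
        = sigma_sets (space L \<times> space N) {a \<times> b |a b. a \<in> sets L \<and> b \<in> G}"
      unfolding sets_kernel_prod[OF \<kappa>' ne] sets_pair[symmetric]
      by (rule sets_pair_measure_cong) auto
    show "range (\<lambda>_::nat. space L \<times> space N) \<subseteq> {a \<times> b |a b. a \<in> sets L \<and> b \<in> G}"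
      using G(4) by auto
    show "(\<Union>i::nat. space L \<times> space N) = space L \<times> space N" by simp
    have "prob_space (distr P (L \<Otimes>\<^sub>M N) (\<lambda>\<omega>. (Y \<omega>, X \<omega>)))"
      by (rule prob_space_distr) measurable
    then show "emeasure (distr P (L \<Otimes>\<^sub>M N) (\<lambda>\<omega>. (Y \<omega>, X \<omega>))) (space L \<times> space N) \<noteq> \<infinity>"
      by (metis prob_space.emeasure_space_1 space_pair_measure space_distr ennreal_one_neq_top infinity_ennreal_def)
    fix C assume "C \<in> {a \<times> b |a b. a \<in> sets L \<and> b \<in> G}"
    then obtain B A where C: "C = B \<times> A" and B [measurable]: "B \<in> sets L" and A: "A \<in> G" by auto
    have [measurable]: "A \<in> sets N" using A G(3) by auto
    have [measurable]: "(\<lambda>y. emeasure (\<kappa> y) A) \<in> borel_measurable L"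
      by (rule measurable_compose[OF measurable_prob_algebraD[OF \<kappa>]]) measurable
    have "emeasure (distr P (L \<Otimes>\<^sub>M N) (\<lambda>\<omega>. (Y \<omega>, X \<omega>))) C
        = emeasure P {\<omega> \<in> space P. Y \<omega> \<in> B \<and> X \<omega> \<in> A}"
      unfolding C by (subst emeasure_distr) (auto intro!: arg_cong[where f="emeasure P"])
    also have "\<dots> = (\<integral>\<^sup>+\<omega>. emeasure (\<kappa> (Y \<omega>)) A * indicator B (Y \<omega>) \<partial>P)"
      using emeasure_rectangle_of_cond_prob[OF P X Y \<kappa> \<open>A \<in> sets N\<close> B cond[OF A]] .
    also have "\<dots> = (\<integral>\<^sup>+y. emeasure (\<kappa> y) A * indicator B y \<partial>distr P L Y)"
      by (subst nn_integral_distr) auto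
    also have "\<dots> = (\<integral>\<^sup>+y. \<integral>\<^sup>+x. indicator C (y, x) \<partial>\<kappa> y \<partial>distr P L Y)"
    proof (rule nn_integral_cong)
      fix y assume "y \<in> space (distr P L Y)"
      then have "sets (\<kappa> y) = sets N"
        using prob_algebra_kernel(2)[OF \<kappa>] by simp
      then show "emeasure (\<kappa> y) A * indicator B y = (\<integral>\<^sup>+x. indicator C (y, x) \<partial>\<kappa> y)"
        unfolding C indicator_times
        by (subst mult.commute) (simp add: nn_integral_cmult_indicator)
    qed
    also have "\<dots> = (\<integral>\<^sup>+p. indicator C p \<partial>kernel_prod (distr P L Y) N \<kappa>)"
      by (subst nn_integral_kernel_prod[OF \<kappa>']) (auto simp: C)
    also have "\<dots> = emeasure (kernel_prod (distr P L Y) N \<kappa>) C"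
    proof (rule nn_integral_indicator)
      have "sets (kernel_prod (distr P L Y) N \<kappa>) = sets (L \<Otimes>\<^sub>M N)"
        unfolding sets_kernel_prod[OF \<kappa>' ne] by (rule sets_pair_measure_cong) auto
      then show "C \<in> sets (kernel_prod (distr P L Y) N \<kappa>)" by (simp add: C)
    qed
    finally show "emeasure (distr P (L \<Otimes>\<^sub>M N) (\<lambda>\<omega>. (Y \<omega>, X \<omega>))) C = emeasure (kernel_prod (distr P L Y) N \<kappa>) C" .
  qed
qed

lemma nn_integral_joint_law:
  assumes X [measurable]: "X \<in> P \<rightarrow>\<^sub>M N" and Y [measurable]: "Y \<in> P \<rightarrow>\<^sub>M L"
    and \<kappa> [measurable]: "\<kappa> \<in> L \<rightarrow>\<^sub>M prob_algebra N"
    and law: "distr P (L \<Otimes>\<^sub>M N) (\<lambda>\<omega>. (Y \<omega>, X \<omega>)) = kernel_prod (distr P L Y) N \<kappa>"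
    and F [measurable]: "F \<in> borel_measurable (L \<Otimes>\<^sub>M N)"
  shows "(\<integral>\<^sup>+\<omega>. F (Y \<omega>, X \<omega>) \<partial>P) = (\<integral>\<^sup>+\<omega>. \<integral>\<^sup>+x. F (Y \<omega>, x) \<partial>\<kappa> (Y \<omega>) \<partial>P)"
proof -
  have \<kappa>': "\<kappa> \<in> distr P L Y \<rightarrow>\<^sub>M prob_algebra N" by simp
  have [measurable]: "(\<lambda>y. \<integral>\<^sup>+x. F (y, x) \<partial>\<kappa> y) \<in> borel_measurable L"
    by (rule nn_integral_measurable_subprob_algebra2[OF _ measurable_prob_algebraD[OF \<kappa>]]) measurable
  have "(\<integral>\<^sup>+\<omega>. F (Y \<omega>, X \<omega>) \<partial>P) = (\<integral>\<^sup>+p. F p \<partial>distr P (L \<Otimes>\<^sub>M N) (\<lambda>\<omega>. (Y \<omega>, X \<omega>)))"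
    by (subst nn_integral_distr) auto
  also have "\<dots> = (\<integral>\<^sup>+y. \<integral>\<^sup>+x. F (y, x) \<partial>\<kappa> y \<partial>distr P L Y)"
    unfolding law by (rule nn_integral_kernel_prod[OF \<kappa>']) simp
  also have "\<dots> = (\<integral>\<^sup>+\<omega>. \<integral>\<^sup>+x. F (Y \<omega>, x) \<partial>\<kappa> (Y \<omega>) \<partial>P)"
    by (subst nn_integral_distr) auto
  finally show ?thesis .
qed

text \<open>Carries statements that hold almost surely under \<open>\<kappa> y\<close>, for fixed \<open>y\<close>, over to the pair of
  random variables \<open>(Y, X)\<close>.\<close>
lemma AE_joint_law:
  assumes X [measurable]: "X \<in> P \<rightarrow>\<^sub>M N" and Y [measurable]: "Y \<in> P \<rightarrow>\<^sub>M L"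
    and \<kappa>: "\<kappa> \<in> L \<rightarrow>\<^sub>M prob_algebra N"
    and law: "distr P (L \<Otimes>\<^sub>M N) (\<lambda>\<omega>. (Y \<omega>, X \<omega>)) = kernel_prod (distr P L Y) N \<kappa>"
    and Q [measurable]: "Measurable.pred (L \<Otimes>\<^sub>M N) Q"
    and AE: "AE \<omega> in P. AE x in \<kappa> (Y \<omega>). Q (Y \<omega>, x)"
  shows "AE \<omega> in P. Q (Y \<omega>, X \<omega>)"
proof -
  let ?F = "\<lambda>p. if Q p then 0 else 1 :: ennreal"
  have "(\<integral>\<^sup>+\<omega>. ?F (Y \<omega>, X \<omega>) \<partial>P) = (\<integral>\<^sup>+\<omega>. \<integral>\<^sup>+x. ?F (Y \<omega>, x) \<partial>\<kappa> (Y \<omega>) \<partial>P)"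
    by (rule nn_integral_joint_law[OF X Y \<kappa> law]) measurable
  also have "\<dots> = (\<integral>\<^sup>+\<omega>. 0 \<partial>P)"
  proof (rule nn_integral_cong_AE)
    show "AE \<omega> in P. (\<integral>\<^sup>+x. ?F (Y \<omega>, x) \<partial>\<kappa> (Y \<omega>)) = 0"
      using AE
    proof eventually_elim
      case (elim \<omega>)
      then have "(\<integral>\<^sup>+x. ?F (Y \<omega>, x) \<partial>\<kappa> (Y \<omega>)) = (\<integral>\<^sup>+x. 0 \<partial>\<kappa> (Y \<omega>))"
        by (intro nn_integral_cong_AE) auto
      then show ?case by simp
    qed
  qed
  finally have "(\<integral>\<^sup>+\<omega>. ?F (Y \<omega>, X \<omega>) \<partial>P) = 0" by simp
  moreover have "(\<lambda>\<omega>. ?F (Y \<omega>, X \<omega>)) \<in> borel_measurable P" by measurable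
  ultimately have "AE \<omega> in P. ?F (Y \<omega>, X \<omega>) = 0" by (simp only: nn_integral_0_iff_AE)
  then show ?thesis by eventually_elim (auto split: if_splits)
qed

lemma nn_integral_reg_cond_dist:
  assumes P: "prob_space P" and R: "reg_cond_dist P X N Y L \<kappa>"
    and F: "F \<in> borel_measurable (L \<Otimes>\<^sub>M N)"
  shows "(\<integral>\<^sup>+\<omega>. F (Y \<omega>, X \<omega>) \<partial>P) = (\<integral>\<^sup>+\<omega>. \<integral>\<^sup>+x. F (Y \<omega>, x) \<partial>\<kappa> (Y \<omega>) \<partial>P)"
proof (rule nn_integral_joint_law[OF _ _ _ _ F])
  show "distr P (L \<Otimes>\<^sub>M N) (\<lambda>\<omega>. (Y \<omega>, X \<omega>)) = kernel_prod (distr P L Y) N \<kappa>"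
  proof (rule joint_law[OF P, where G="sets N"])
    show "Int_stable (sets N)" by (auto simp: Int_stable_def)
  qed (use R in \<open>auto simp: reg_cond_dist_def sets.sigma_sets_eq dest: sets.sets_into_space\<close>)
qed (use R in \<open>auto simp: reg_cond_dist_def\<close>)

lemma measurable_PiM_kernel:
  assumes \<kappa>: "\<kappa> \<in> L \<rightarrow>\<^sub>M prob_algebra N"
  shows "(\<lambda>y. PiM UNIV (\<lambda>_::nat. \<kappa> y)) \<in> L \<rightarrow>\<^sub>M prob_algebra (PiM UNIV (\<lambda>_. N))"
proof (rule measurable_prob_algebra_generated[OF sets_PiM Int_stable_prod_algebra prod_algebra_sets_into_space])
  fix y assume y: "y \<in> space L"
  show "prob_space (PiM UNIV (\<lambda>_::nat. \<kappa> y))"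
    by (intro prob_space_PiM prob_algebra_kernel(1)[OF \<kappa> y])
  show "sets (PiM UNIV (\<lambda>_::nat. \<kappa> y)) = sets (PiM UNIV (\<lambda>_. N))"
    by (intro sets_PiM_cong prob_algebra_kernel(2)[OF \<kappa> y] refl)
next
  fix A assume "A \<in> prod_algebra UNIV (\<lambda>_::nat. N)"
  then show "(\<lambda>y. emeasure (PiM UNIV (\<lambda>_. \<kappa> y)) A) \<in> borel_measurable L"
  proof (cases rule: prod_algebraE)
    case (1 J E)
    then have [measurable]: "(\<lambda>y. \<Prod>i\<in>J. emeasure (\<kappa> y) (E i)) \<in> borel_measurable L"
      by (intro borel_measurable_prod_ennreal measurable_compose[OF measurable_prob_algebraD[OF \<kappa>]]
          measurable_emeasure_subprob_algebra) auto
    have "emeasure (PiM UNIV (\<lambda>_. \<kappa> y)) A = (\<Prod>i\<in>J. emeasure (\<kappa> y) (E i))" if y: "y \<in> space L" for y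
    proof -
      have "A = prod_emb UNIV (\<lambda>_. \<kappa> y) J (PiE J E)"
        using 1 prob_algebra_kernel(3)[OF \<kappa> y] by (simp add: prod_emb_def)
      then show ?thesis
        using 1 prob_algebra_kernel[OF \<kappa> y] by (simp add: emeasure_PiM_emb)
    qed
    then show ?thesis by (subst measurable_cong) auto
  qed
qed

text \<open>The sequence \<open>X\<close> starts at index \<open>1\<close> and the infinite product at index \<open>0\<close>, hence the shift by
  \<open>Suc\<close>.\<close>
lemma joint_law_cond_iid:
  assumes P: "prob_space P" and R: "cond_iid P X N Y L \<kappa>"
  shows "distr P (L \<Otimes>\<^sub>M PiM UNIV (\<lambda>_. N)) (\<lambda>\<omega>. (Y \<omega>, \<lambda>k. X (Suc k) \<omega>))
    = kernel_prod (distr P L Y) (PiM UNIV (\<lambda>_. N)) (\<lambda>y. PiM UNIV (\<lambda>_::nat. \<kappa> y))"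
proof -
  have X [measurable]: "X (Suc k) \<in> P \<rightarrow>\<^sub>M N" for k
    using R by (auto simp: cond_iid_def)
  have Y [measurable]: "Y \<in> P \<rightarrow>\<^sub>M L" and \<kappa>: "\<kappa> \<in> L \<rightarrow>\<^sub>M prob_algebra N"
    using R by (auto simp: cond_iid_def)
  show ?thesis
  proof (rule joint_law[OF P _ Y measurable_PiM_kernel[OF \<kappa>] Int_stable_prod_algebra])
    show "(\<lambda>\<omega> k. X (Suc k) \<omega>) \<in> P \<rightarrow>\<^sub>M PiM UNIV (\<lambda>_. N)"
      by (rule measurable_PiM_single') (use measurable_space[OF X] in auto)
    show "prod_algebra UNIV (\<lambda>_::nat. N) \<subseteq> Pow (space (PiM UNIV (\<lambda>_. N)))"
      using prod_algebra_sets_into_space[of UNIV "\<lambda>_. N"] by (simp add: space_PiM)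
    show "sets (PiM UNIV (\<lambda>_::nat. N)) = sigma_sets (space (PiM UNIV (\<lambda>_. N))) (prod_algebra UNIV (\<lambda>_. N))"
      by (simp add: space_PiM sets_PiM)
    have "prod_emb UNIV (\<lambda>_. N) {0::nat} (PiE {0} (\<lambda>_. space N)) \<in> prod_algebra UNIV (\<lambda>_. N)"
      by (rule prod_algebraI) auto
    also have "prod_emb UNIV (\<lambda>_. N) {0::nat} (PiE {0} (\<lambda>_. space N)) = space (PiM UNIV (\<lambda>_. N))"
      by (auto simp: prod_emb_def space_PiM PiE_iff)
    finally show "space (PiM UNIV (\<lambda>_::nat. N)) \<in> prod_algebra UNIV (\<lambda>_. N)" .
    fix C assume "C \<in> prod_algebra UNIV (\<lambda>_::nat. N)"
    then obtain J E where C: "C = prod_emb UNIV (\<lambda>_. N) J (PiE J E)" and J: "finite J"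
      and E: "\<And>j. j \<in> J \<Longrightarrow> E j \<in> sets N" by (elim prod_algebraE) blast
    obtain K where K: "J \<subseteq> {..<K}" using J by (meson finite_nat_bounded)
    \<comment> \<open>Coordinates that the cylinder leaves free are constrained by the whole space.\<close>
    define A where "A k = (if k - 1 \<in> J then E (k - 1) else space N)" for k
    have A: "\<forall>k\<in>{1..K}. A k \<in> sets N" using E by (auto simp: A_def)
    have "(\<lambda>\<omega> k. X (Suc k) \<omega>) -` C \<inter> space P = {\<omega> \<in> space P. \<forall>k\<in>{1..K}. X k \<omega> \<in> A k}" (is "?l = ?r")
    proof (intro set_eqI iffI)
      fix \<omega> assume "\<omega> \<in> ?l"
      then show "\<omega> \<in> ?r" using measurable_space[OF X]
        by (auto simp: C prod_emb_def A_def PiE_iff) (metis Suc_pred' less_eq_Suc_le)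
    next
      fix \<omega> assume \<omega>: "\<omega> \<in> ?r"
      have "X (Suc k) \<omega> \<in> E k" if "k \<in> J" for k
        using \<omega> K that by (auto simp: A_def dest!: bspec[of _ _ "Suc k"])
      then show "\<omega> \<in> ?l" using \<omega> measurable_space[OF X]
        by (auto simp: C prod_emb_def PiE_iff)
    qed
    moreover have "measure (PiM UNIV (\<lambda>_::nat. \<kappa> y)) C = (\<Prod>k=1..K. measure (\<kappa> y) (A k))" if y: "y \<in> space L" for y
    proof -
      interpret K: prob_space "\<kappa> y" using prob_algebra_kernel(1)[OF \<kappa> y] .
      interpret product_prob_space "\<lambda>_. \<kappa> y" "UNIV :: nat set" by unfold_locales
      have "C = prod_emb UNIV (\<lambda>_. \<kappa> y) J (PiE J E)"
        using C prob_algebra_kernel(3)[OF \<kappa> y] by (simp add: prod_emb_def)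
      then have "measure (PiM UNIV (\<lambda>_::nat. \<kappa> y)) C = (\<Prod>k\<in>J. measure (\<kappa> y) (E k))"
        using J E prob_algebra_kernel(2)[OF \<kappa> y] by (simp add: measure_PiM_emb)
      also have "\<dots> = (\<Prod>k<K. measure (\<kappa> y) (A (Suc k)))"
        by (rule prod.mono_neutral_cong_left)
           (use K K.prob_space prob_algebra_kernel(3)[OF \<kappa> y] in \<open>auto simp: A_def\<close>)
      also have "\<dots> = (\<Prod>k=1..K. measure (\<kappa> y) (A k))"
        by (rule prod.reindex_bij_witness[of _ "\<lambda>k. k - 1" Suc]) auto
      finally show ?thesis .
    qed
    moreover have "AE \<omega> in P. real_cond_exp P (vimage_algebra (space P) Y L)
            (indicator {\<omega> \<in> space P. \<forall>k\<in>{1..K}. X k \<omega> \<in> A k}) \<omega>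
          = (\<Prod>k=1..K. measure (\<kappa> (Y \<omega>)) (A k))"
      using R A by (auto simp: cond_iid_def)
    ultimately show "AE \<omega> in P. measure (PiM UNIV (\<lambda>_::nat. \<kappa> (Y \<omega>))) C =
        real_cond_exp P (vimage_algebra (space P) Y L) (indicator ((\<lambda>\<omega> k. X (Suc k) \<omega>) -` C \<inter> space P)) \<omega>"
      using AE_space by (auto elim!: eventually_mono simp: measurable_space[OF Y])
  qed
qed

lemma AE_cond_iid:
  assumes P: "prob_space P" and R: "cond_iid P X N Y L \<kappa>"
    and Q: "Measurable.pred (L \<Otimes>\<^sub>M PiM UNIV (\<lambda>_. N)) Q"
    and AE: "AE \<omega> in P. AE \<zeta> in PiM UNIV (\<lambda>_. \<kappa> (Y \<omega>)). Q (Y \<omega>, \<zeta>)"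
  shows "AE \<omega> in P. Q (Y \<omega>, \<lambda>k. X (Suc k) \<omega>)"
proof -
  have X: "X (Suc k) \<in> P \<rightarrow>\<^sub>M N" for k
    using R by (auto simp: cond_iid_def)
  have X': "(\<lambda>\<omega> k. X (Suc k) \<omega>) \<in> P \<rightarrow>\<^sub>M PiM UNIV (\<lambda>_. N)"
    by (rule measurable_PiM_single') (use measurable_space[OF X] X in auto)
  show ?thesis
    by (rule AE_joint_law[OF X' _ measurable_PiM_kernel joint_law_cond_iid[OF P R] Q AE])
      (use R in \<open>auto simp: cond_iid_def\<close>)
qed

section \<open>The strong law of large numbers for conditionally i.i.d. sequences\<close>

text \<open>Restricting \<open>\<epsilon>\<close> to the values \<open>1 / (j + 1)\<close> leaves only countable quantifiers.\<close>
lemma pred_LIMSEQ: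
  fixes a :: "nat \<Rightarrow> 'x \<Rightarrow> real"
  assumes [measurable]: "\<And>n. a n \<in> borel_measurable N" "l \<in> borel_measurable N"
  shows "Measurable.pred N (\<lambda>x. (\<lambda>n. a n x) \<longlonglongrightarrow> l x)"
proof -
  have "(\<lambda>n. a n x) \<longlonglongrightarrow> l x \<longleftrightarrow> (\<forall>j. \<exists>n0. \<forall>n\<ge>n0. dist (a n x) (l x) < inverse (Suc j))" for x
    unfolding lim_sequentially
  proof safe
    fix r :: real assume H: "\<forall>j. \<exists>n0. \<forall>n\<ge>n0. dist (a n x) (l x) < inverse (Suc j)" and "0 < r"
    obtain j where j: "inverse (Suc j) < r" using reals_Archimedean[OF \<open>0 < r\<close>] by auto
    obtain n0 where "\<forall>n\<ge>n0. dist (a n x) (l x) < inverse (Suc j)" using H by blast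
    with j show "\<exists>n0. \<forall>n\<ge>n0. dist (a n x) (l x) < r" by (auto intro: less_trans)
  qed simp
  then show ?thesis by (simp add: dist_real_def)
qed

text \<open>For almost every value \<open>y\<close> of \<open>Y\<close> the sequence has the law of an i.i.d. sequence with marginal
  \<open>\<kappa> y\<close>, to which the strong law applies with \<open>y\<close> held fixed.\<close>
theorem conditional_strong_law:
  fixes g :: "'y \<times> 'x \<Rightarrow> real"
  assumes P: "prob_space P" and R: "cond_iid P X N Y L \<kappa>"
    and g: "g \<in> borel_measurable (L \<Otimes>\<^sub>M N)"
    and int: "AE \<omega> in P. integrable (\<kappa> (Y \<omega>)) (\<lambda>x. g (Y \<omega>, x))"
  shows "AE \<omega> in P. (\<lambda>K. (\<Sum>k<K. g (Y \<omega>, X (Suc k) \<omega>)) / K) \<longlonglongrightarrow> (\<integral>x. g (Y \<omega>, x) \<partial>\<kappa> (Y \<omega>))"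
proof -
  have Y: "Y \<in> P \<rightarrow>\<^sub>M L" and \<kappa>: "\<kappa> \<in> L \<rightarrow>\<^sub>M prob_algebra N"
    using R by (auto simp: cond_iid_def)
  let ?Q = "\<lambda>p. (\<lambda>K::nat. (\<Sum>k<K. g (fst p, snd p (k::nat))) / K) \<longlonglongrightarrow> (\<integral>x. g (fst p, x) \<partial>\<kappa> (fst p))"
  have "AE \<omega> in P. ?Q (Y \<omega>, \<lambda>k. X (Suc k) \<omega>)"
  proof (rule AE_cond_iid[OF P R, of ?Q])
    \<comment> \<open>The limit depends measurably on \<open>y\<close>: it is the integral of one function against a kernel.\<close>
    have "(\<lambda>y. distr (\<kappa> y) (L \<Otimes>\<^sub>M N) (Pair y)) \<in> L \<rightarrow>\<^sub>M subprob_algebra (L \<Otimes>\<^sub>M N)"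
      by (rule measurable_prob_algebraD, rule measurable_distr_prob_space2[OF \<kappa>]) measurable
    from measurable_compose[OF this integral_measurable_subprob_algebra[OF g]]
    have "(\<lambda>y. \<integral>p. g p \<partial>distr (\<kappa> y) (L \<Otimes>\<^sub>M N) (Pair y)) \<in> borel_measurable L" .
    also have "?this \<longleftrightarrow> (\<lambda>y. \<integral>x. g (y, x) \<partial>\<kappa> y) \<in> borel_measurable L"
    proof (rule measurable_cong)
      fix y assume y: "y \<in> space L"
      then have "Pair y \<in> \<kappa> y \<rightarrow>\<^sub>M L \<Otimes>\<^sub>M N"
        using prob_algebra_kernel(2)[OF \<kappa> y] by (simp cong: measurable_cong_sets)
      then show "(\<integral>p. g p \<partial>distr (\<kappa> y) (L \<Otimes>\<^sub>M N) (Pair y)) = (\<integral>x. g (y, x) \<partial>\<kappa> y)"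
        using g by (simp add: integral_distr)
    qed
    finally have "(\<lambda>y. \<integral>x. g (y, x) \<partial>\<kappa> y) \<in> borel_measurable L" .
    moreover have "(\<lambda>p. g (fst p, snd p k)) \<in> borel_measurable (L \<Otimes>\<^sub>M PiM UNIV (\<lambda>_::nat. N))" for k
      by (rule measurable_compose[OF _ g]) measurable
    ultimately show "Measurable.pred (L \<Otimes>\<^sub>M PiM UNIV (\<lambda>_::nat. N)) ?Q"
      by (intro pred_LIMSEQ) auto
    show "AE \<omega> in P. AE \<zeta> in PiM UNIV (\<lambda>_. \<kappa> (Y \<omega>)). ?Q (Y \<omega>, \<zeta>)"
      using int AE_space
    proof eventually_elim
      case (elim \<omega>)
      interpret K: prob_space "\<kappa> (Y \<omega>)"
        by (rule prob_algebra_kernel(1)[OF \<kappa> measurable_space[OF Y elim(2)]])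
      interpret sequence_space "\<kappa> (Y \<omega>)" by unfold_locales
      show ?case using strong_law_of_large_numbers[OF elim(1)] by simp
    qed
  qed
  then show ?thesis by simp
qed


section \<open>Weak convergence from countably many test functions\<close>

text \<open>The pair \<open>(0, {})\<close> gives the empty family the maximum \<open>0\<close> and makes the function nonnegative.\<close>
definition step_max :: "(real \<times> 'x set) set \<Rightarrow> 'x \<Rightarrow> real" where
  "step_max F x = Max ((\<lambda>p. fst p * indicator (snd p) x) ` insert (0, {}) F)"

lemma step_max_le:
  assumes "finite F" "0 \<le> c" "\<And>q U. (q, U) \<in> F \<Longrightarrow> x \<in> U \<Longrightarrow> q \<le> c"
  shows "step_max F x \<le> c"
  unfolding step_max_def using assms by (subst Max_le_iff) (auto simp: indicator_def)

lemma step_max_ge: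
  assumes "finite F" "(q, U) \<in> F" "x \<in> U"
  shows "q \<le> step_max F x"
  unfolding step_max_def using assms
  by (intro Max_ge) (auto intro!: rev_image_eqI[of "(q, U)"])

lemma step_max_nonneg: "finite F \<Longrightarrow> 0 \<le> step_max F x"
  unfolding step_max_def by (intro Max_ge) auto

lemma borel_measurable_step_max:
  assumes "finite F" "\<And>q U. (q, U) \<in> F \<Longrightarrow> U \<in> sets N"
  shows "step_max F \<in> borel_measurable N"
proof -
  have "(\<lambda>x. fst p * indicator (snd p) x :: real) \<in> borel_measurable N" if "p \<in> insert (0, {}) F" for p
    using that assms(2)[of "fst p" "snd p"] by auto
  then show ?thesis
    unfolding step_max_def[abs_def] using assms(1) by (intro borel_measurable_Max) auto
qed

definition basic_boxes :: "nat \<Rightarrow> (nat \<Rightarrow> 's::second_countable_topology) set set" where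
  "basic_boxes M = PiE {1..M} ` PiE {1..M} (\<lambda>_. SOME B. countable B \<and> topological_basis B)"

lemma countable_basic_boxes: "countable (basic_boxes M)"
  unfolding basic_boxes_def
  by (intro countable_image countable_PiE) (simp_all add: countable_basis)

lemma sets_basic_boxes:
  assumes "U \<in> basic_boxes M" shows "U \<in> sets (vec_measure borel M)"
proof -
  obtain V where V: "U = PiE {1..M} V" "V \<in> PiE {1..M} (\<lambda>_. SOME B. countable B \<and> topological_basis B)"
    using assms unfolding basic_boxes_def by auto
  have "open (V i)" if "i \<in> {1..M}" for i
    using PiE_mem[OF V(2) that] topological_basis_open[OF is_basis] by blast
  then show ?thesis unfolding V(1) by (intro sets_PiM_I_finite) auto
qed

lemma ex_basic_box:
  fixes x :: "nat \<Rightarrow> 's::second_countable_topology"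
  assumes "openin (product_topology (\<lambda>_. euclidean) {1..M}) W" "x \<in> W"
  obtains U where "U \<in> basic_boxes M" "x \<in> U" "U \<subseteq> W"
proof -
  obtain V where V: "\<And>i. i \<in> {1..M} \<Longrightarrow> open (V i)" "x \<in> PiE {1..M} V" "PiE {1..M} V \<subseteq> W"
    using assms unfolding openin_product_topology_alt by (metis (no_types, lifting) open_openin)
  have "\<exists>B. B \<in> (SOME B. countable B \<and> topological_basis B) \<and> x i \<in> B \<and> B \<subseteq> V i" if "i \<in> {1..M}" for i
  proof -
    have "x i \<in> V i" using V(2) that by (simp add: PiE_iff)
    from topological_basisE[OF is_basis V(1)[OF that] this] show ?thesis by metis
  qed
  then obtain B where B: "\<And>i. i \<in> {1..M} \<Longrightarrow>
      B i \<in> (SOME B. countable B \<and> topological_basis B) \<and> x i \<in> B i \<and> B i \<subseteq> V i"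
    by metis
  have "PiE {1..M} (restrict B {1..M}) \<in> basic_boxes M"
    unfolding basic_boxes_def using B by (intro imageI) auto
  moreover have "PiE {1..M} (restrict B {1..M}) = PiE {1..M} B"
    by (intro PiE_cong) auto
  moreover have "x \<in> PiE {1..M} B" using V(2) B by (auto simp: PiE_iff)
  moreover have "PiE {1..M} B \<subseteq> W"
    using V(3) B by (meson PiE_mono order_trans)
  ultimately show ?thesis using that by simp
qed

text \<open>Rational heights and boxes from a countable basis keep the family countable, so that a statement
  that holds almost surely for each member holds almost surely for all of them.\<close>
definition test_functions :: "nat \<Rightarrow> ((nat \<Rightarrow> 's::second_countable_topology) \<Rightarrow> real) set" where
  "test_functions M = step_max ` {F. finite F \<and> F \<subseteq> \<rat> \<times> basic_boxes M}"

lemma countable_test_functions: "countable (test_functions M)"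
  unfolding test_functions_def
  by (intro countable_image countable_Collect_finite_subset countable_SIGMA countable_rat countable_basic_boxes)

lemma test_functions_bounded_measurable:
  assumes "h \<in> test_functions M"
  shows "h \<in> borel_measurable (vec_measure borel M)" "0 \<le> h x" "\<exists>c. \<forall>x. h x \<le> c"
proof -
  obtain F where F: "h = step_max F" "finite F" "F \<subseteq> \<rat> \<times> basic_boxes M"
    using assms by (auto simp: test_functions_def)
  show "h \<in> borel_measurable (vec_measure borel M)"
    unfolding F(1) using F sets_basic_boxes by (intro borel_measurable_step_max) auto
  show "0 \<le> h x" unfolding F(1) using F(2) by (rule step_max_nonneg)
  have "h x \<le> (\<Sum>p\<in>F. \<bar>fst p\<bar>)" for x
    unfolding F(1)
  proof (rule step_max_le[OF F(2)])
    fix q U assume "(q, U) \<in> F"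
    then have "\<bar>fst (q, U)\<bar> \<le> (\<Sum>p\<in>F. \<bar>fst p\<bar>)"
      by (intro member_le_sum F) auto
    then show "q \<le> (\<Sum>p\<in>F. \<bar>fst p\<bar>)" by simp
  qed (auto intro: sum_nonneg)
  then show "\<exists>c. \<forall>x. h x \<le> c" by blast
qed

text \<open>Enumerate all pairs of a rational \<open>q\<close> and a basic box on which \<open>g \<ge> q\<close>. The maxima over the
  first \<open>j\<close> pairs stay below \<open>g\<close>. They reach every rational \<open>q < g x\<close>, because by continuity
  \<open>g > q\<close> on some basic box around \<open>x\<close>.\<close>
lemma test_functions_approximate:
  fixes g :: "(nat \<Rightarrow> 's::second_countable_topology) \<Rightarrow> real"
  assumes g: "continuous_map (product_topology (\<lambda>_. euclidean) {1..M}) euclideanreal g"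
    and nonneg: "\<And>x. x \<in> space (vec_measure borel M) \<Longrightarrow> 0 \<le> g x"
  obtains h where "\<And>j::nat. h j \<in> test_functions M"
    and "\<And>j x. x \<in> space (vec_measure borel M) \<Longrightarrow> h j x \<le> g x"
    and "\<And>x. x \<in> space (vec_measure borel M) \<Longrightarrow> (\<lambda>j. h j x) \<longlonglongrightarrow> g x"
proof -
  have top: "topspace (product_topology (\<lambda>_. euclidean) {1..M}) = space (vec_measure (borel :: 's measure) M)"
    by (simp add: space_PiM)
  define S where "S = {(q, U) \<in> \<rat> \<times> basic_boxes M. \<forall>x\<in>U. q \<le> g x}"
  have "countable S"
    by (rule countable_subset[of _ "\<rat> \<times> basic_boxes M"])
       (auto simp: S_def intro: countable_rat countable_basic_boxes)
  define F where "F j = {p \<in> S. to_nat_on S p < j}" for j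
  have finF: "finite (F j)" for j
  proof -
    have "F j = to_nat_on S -` {..<j} \<inter> S" by (auto simp: F_def)
    then show ?thesis
      using \<open>countable S\<close> by (simp add: finite_vimage_IntI inj_on_to_nat_on)
  qed
  have le: "step_max (F j) x \<le> g x" if "x \<in> space (vec_measure borel M)" for j x
    by (rule step_max_le[OF finF nonneg[OF that]]) (auto simp: F_def S_def)
  show ?thesis
  proof (rule that[of "\<lambda>j. step_max (F j)"])
    show "step_max (F j) \<in> test_functions M" for j
      unfolding test_functions_def using finF[of j] by (intro imageI) (auto simp: F_def S_def)
    show "step_max (F j) x \<le> g x" if "x \<in> space (vec_measure borel M)" for j x
      by (rule le[OF that])
    fix x :: "nat \<Rightarrow> 's" assume x: "x \<in> space (vec_measure borel M)"
    show "(\<lambda>j. step_max (F j) x) \<longlonglongrightarrow> g x"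
    proof (rule order_tendstoI)
      fix a assume "g x < a"
      then show "eventually (\<lambda>j. step_max (F j) x < a) sequentially"
        using le_less_trans[OF le[OF x]] by (intro always_eventually) blast
    next
      fix a assume "a < g x"
      then obtain q where q: "q \<in> \<rat>" "a < q" "q < g x" using Rats_dense_in_real by blast
      have "openin (product_topology (\<lambda>_. euclidean) {1..M}) {x \<in> topspace (product_topology (\<lambda>_. euclidean) {1..M}). g x \<in> {q<..}}"
        using g by (rule openin_continuous_map_preimage) (metis open_openin open_greaterThan)
      then obtain U where U: "U \<in> basic_boxes M" "x \<in> U"
          "U \<subseteq> {x \<in> topspace (product_topology (\<lambda>_. euclidean) {1..M}). g x \<in> {q<..}}"
        by (rule ex_basic_box) (use x q top in simp)
      then have pS: "(q, U) \<in> S" using q by (auto simp: S_def less_imp_le)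
      have "a < step_max (F j) x" if "j \<ge> Suc (to_nat_on S (q, U))" for j
      proof -
        have "(q, U) \<in> F j" using pS that by (auto simp: F_def)
        from step_max_ge[OF finF this U(2)] q show ?thesis by simp
      qed
      then show "eventually (\<lambda>j. a < step_max (F j) x) sequentially"
        unfolding eventually_sequentially by blast
    qed
  qed
qed

text \<open>A test function \<open>h \<le> g\<close> with nearly the same \<open>\<nu>\<close>-integral bounds the integrals of a continuous
  \<open>g \<ge> 0\<close> from below in the limit. For bounded \<open>g\<close> this is used with \<open>C + g\<close> and \<open>C - g\<close>. The
  assumption on \<open>\<mu>\<close> concerns large \<open>K\<close>, because empirical measures start with \<open>K = 1\<close>.\<close>
lemma weakly_converges_if_test_functions:
  fixes \<mu> :: "nat \<Rightarrow> (nat \<Rightarrow> 's::second_countable_topology) measure"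
  assumes \<mu>: "eventually (\<lambda>K. prob_space (\<mu> K) \<and> sets (\<mu> K) = sets (vec_measure borel M)) sequentially"
    and \<nu>: "prob_space \<nu>" "sets \<nu> = sets (vec_measure borel M)"
    and conv: "\<And>h. h \<in> test_functions M \<Longrightarrow> (\<lambda>K. \<integral>x. h x \<partial>\<mu> K) \<longlonglongrightarrow> (\<integral>x. h x \<partial>\<nu>)"
  shows "weakly_converges (product_topology (\<lambda>_. euclidean) {1..M}) \<mu> \<nu>"
proof -
  let ?T = "product_topology (\<lambda>_. euclidean) {1..M} :: (nat \<Rightarrow> 's) topology"
  let ?V = "vec_measure (borel :: 's measure) M"
  have top: "topspace ?T = space ?V" by (simp add: space_PiM)
  interpret \<nu>: prob_space \<nu> by fact
  have sp\<nu>: "space \<nu> = space ?V" using \<nu>(2) by (rule sets_eq_imp_space_eq)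
  have lower: "g \<in> borel_measurable ?V \<and> (\<forall>a < (\<integral>x. g x \<partial>\<nu>). eventually (\<lambda>K. a < (\<integral>x. g x \<partial>\<mu> K)) sequentially)"
    if g: "continuous_map ?T euclideanreal g" and b: "\<And>x. x \<in> space ?V \<Longrightarrow> 0 \<le> g x \<and> g x \<le> C" for g C
  proof -
    obtain h where h: "\<And>j::nat. h j \<in> test_functions M"
      and le: "\<And>j x. x \<in> space ?V \<Longrightarrow> h j x \<le> g x"
      and lim: "\<And>x. x \<in> space ?V \<Longrightarrow> (\<lambda>j. h j x) \<longlonglongrightarrow> g x"
      using test_functions_approximate[OF g] b by blast
    note hm = test_functions_bounded_measurable[OF h]
    have gm: "g \<in> borel_measurable ?V"
      using lim hm(1) by (rule borel_measurable_LIMSEQ_real)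
    have hC: "norm (h j x) \<le> C" and gC: "norm (g x) \<le> C" if "x \<in> space ?V" for j x
      using hm(2)[of j x] le[OF that, of j] b[OF that] by simp_all
    have meas: "h j \<in> borel_measurable \<rho>" "g \<in> borel_measurable \<rho>" if "sets \<rho> = sets ?V" for j \<rho>
      using hm(1) gm by (simp_all add: measurable_cong_sets[OF that refl])
    have lim\<nu>: "(\<lambda>j. \<integral>x. h j x \<partial>\<nu>) \<longlonglongrightarrow> (\<integral>x. g x \<partial>\<nu>)"
    proof (rule integral_dominated_convergence[where w="\<lambda>_. C"])
      show "AE x in \<nu>. (\<lambda>j. h j x) \<longlonglongrightarrow> g x" using lim sp\<nu> by (intro AE_I2) simp
      show "AE x in \<nu>. norm (h j x) \<le> C" for j
        using hC sp\<nu> by (intro AE_I2) simp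
    qed (use meas[OF \<nu>(2)] in simp_all)
    have "eventually (\<lambda>K. a < (\<integral>x. g x \<partial>\<mu> K)) sequentially" if a: "a < (\<integral>x. g x \<partial>\<nu>)" for a
    proof -
      obtain j where j: "a < (\<integral>x. h j x \<partial>\<nu>)"
        using order_tendstoD(1)[OF lim\<nu> a] by (auto simp: eventually_sequentially)
      from order_tendstoD(1)[OF conv[OF h] j] \<mu> show ?thesis
      proof eventually_elim
        case (elim K)
        interpret \<mu>: prob_space "\<mu> K" using elim by simp
        have spK: "space (\<mu> K) = space ?V" using elim by (auto dest: sets_eq_imp_space_eq)
        have "(\<integral>x. h j x \<partial>\<mu> K) \<le> (\<integral>x. g x \<partial>\<mu> K)"
        proof (rule integral_mono)
          have sK: "sets (\<mu> K) = sets ?V" using elim by simp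
          show "integrable (\<mu> K) (h j)"
            using hC spK by (intro \<mu>.integrable_const_bound[where B=C] AE_I2 meas(1)[OF sK]) simp
          show "integrable (\<mu> K) g"
            using gC spK by (intro \<mu>.integrable_const_bound[where B=C] AE_I2 meas(2)[OF sK]) simp
        qed (simp add: le spK)
        with elim show ?case by simp
      qed
    qed
    with gm show ?thesis by blast
  qed
  show ?thesis
    unfolding weakly_converges_def
  proof safe
    fix g assume g: "continuous_map ?T euclideanreal g" and "bounded (g ` topspace ?T)"
    then obtain C where C: "\<And>x. x \<in> space ?V \<Longrightarrow> \<bar>g x\<bar> \<le> C"
      unfolding top bounded_iff by auto
    have up: "continuous_map ?T euclideanreal (\<lambda>x. C + g x)"
      and lo: "continuous_map ?T euclideanreal (\<lambda>x. C - g x)"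
      using g by (intro continuous_map_add continuous_map_diff; simp)+
    have bd: "0 \<le> C + g x \<and> C + g x \<le> 2 * C" "0 \<le> C - g x \<and> C - g x \<le> 2 * C" if "x \<in> space ?V" for x
      using C[OF that] by auto
    note L1 = lower[OF up bd(1)] and L2 = lower[OF lo bd(2)]
    have "(\<lambda>x. (C + g x) - C) \<in> borel_measurable ?V"
      by (intro borel_measurable_diff L1[THEN conjunct1] borel_measurable_const)
    then have gm: "g \<in> borel_measurable ?V" by simp
    have int: "integrable \<rho> g" if "prob_space \<rho>" "sets \<rho> = sets ?V" for \<rho>
    proof -
      interpret prob_space \<rho> by fact
      show ?thesis
      proof (rule integrable_const_bound[where B=C])
        show "AE x in \<rho>. norm (g x) \<le> C"
          using C sets_eq_imp_space_eq[OF that(2)] by (intro AE_I2) simp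
        show "g \<in> borel_measurable \<rho>"
          using gm by (simp add: measurable_cong_sets[OF that(2) refl])
      qed
    qed
    have shift: "(\<integral>x. C + g x \<partial>\<rho>) = C + (\<integral>x. g x \<partial>\<rho>)" "(\<integral>x. C - g x \<partial>\<rho>) = C - (\<integral>x. g x \<partial>\<rho>)"
      if "prob_space \<rho>" "sets \<rho> = sets ?V" for \<rho>
    proof -
      interpret prob_space \<rho> by fact
      show "(\<integral>x. C + g x \<partial>\<rho>) = C + (\<integral>x. g x \<partial>\<rho>)" "(\<integral>x. C - g x \<partial>\<rho>) = C - (\<integral>x. g x \<partial>\<rho>)"
        using int[OF that] by (simp_all add: prob_space)
    qed
    show "(\<lambda>K. \<integral>x. g x \<partial>\<mu> K) \<longlonglongrightarrow> (\<integral>x. g x \<partial>\<nu>)"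
    proof (rule order_tendstoI)
      fix a assume "a < (\<integral>x. g x \<partial>\<nu>)"
      then have "eventually (\<lambda>K. C + a < (\<integral>x. C + g x \<partial>\<mu> K)) sequentially"
        by (intro L1[THEN conjunct2, rule_format]) (simp_all add: shift[OF \<nu>])
      with \<mu> show "eventually (\<lambda>K. a < (\<integral>x. g x \<partial>\<mu> K)) sequentially"
      proof eventually_elim
        case (elim K)
        then have "prob_space (\<mu> K)" "sets (\<mu> K) = sets ?V" by auto
        from shift(1)[OF this] elim show ?case by linarith
      qed
    next
      fix a assume "(\<integral>x. g x \<partial>\<nu>) < a"
      then have "eventually (\<lambda>K. C - a < (\<integral>x. C - g x \<partial>\<mu> K)) sequentially"
        by (intro L2[THEN conjunct2, rule_format]) (simp_all add: shift[OF \<nu>])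
      with \<mu> show "eventually (\<lambda>K. (\<integral>x. g x \<partial>\<mu> K) < a) sequentially"
      proof eventually_elim
        case (elim K)
        then have "prob_space (\<mu> K)" "sets (\<mu> K) = sets ?V" by auto
        from shift(2)[OF this] elim show ?case by linarith
      qed
    qed
  qed
qed

section \<open>Weights and truncated vectors\<close>

(* Index sets have the form {1..m}; the simplifier would turn them into {Suc 0..m}, and the facts
   about vec_measure would no longer match. *)
declare One_nat_def [simp del]

lemma merge_restrict_fst: "merge I J (restrict y I, u) = merge I J (y, u)"
  by (auto simp: merge_def fun_eq_iff)

lemma marg_yz_restrict: "marg_yz M NT h J (restrict y J) z = marg_yz M NT h J y z"
  by (simp add: marg_yz_def merge_restrict_fst)

lemma marg_y_restrict: "marg_y M NT N h J (restrict y J) = marg_y M NT N h J y"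
  by (simp add: marg_y_def marg_yz_restrict)

lemma restrict_restrict_sub: "j \<le> k \<Longrightarrow> restrict (restrict y {1..k}) {1..j} = restrict y {1..j::nat}"
  by (auto simp: fun_eq_iff)

lemma restrict_update: "j \<le> k \<Longrightarrow> restrict (y(Suc k := t)) {1..j} = restrict y {1..j::nat}"
  by (auto simp: fun_eq_iff)

lemma atLeastAtMost_insert: "{1..Suc m} = insert (Suc m) {1..m}"
  by auto

lemma restrict_space_vec: "y \<in> space (vec_measure N k) \<Longrightarrow> restrict y {1..k} = y"
  by (auto simp: space_PiM extensional_restrict)

lemma measurable_vec_update:
  "(\<lambda>(y, t). y(Suc m := t)) \<in> vec_measure N m \<Otimes>\<^sub>M N \<rightarrow>\<^sub>M vec_measure N (Suc m)"
  using measurable_add_dim[of "Suc m" "{1..m}" "\<lambda>_. N"] by (simp add: atLeastAtMost_insert)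

lemma measurable_vec_restrict:
  "m \<le> k \<Longrightarrow> (\<lambda>y. restrict y {1..m}) \<in> vec_measure N k \<rightarrow>\<^sub>M vec_measure N m"
  by (rule measurable_restrict_subset) auto

text \<open>The factors of the weight up to index \<open>m\<close>, which involve the first \<open>m\<close> coordinates of \<open>y\<close> and the
  first \<open>m - 1\<close> coordinates of \<open>z\<close>.\<close>
definition partial_weight ::
  "nat \<Rightarrow> 't measure \<Rightarrow> (nat \<Rightarrow> (nat \<Rightarrow> 's) measure) \<Rightarrow> (nat \<Rightarrow> (nat \<Rightarrow> 't) \<times> (nat \<Rightarrow> 's) \<Rightarrow> ennreal)
     \<Rightarrow> nat \<Rightarrow> (nat \<Rightarrow> 't) \<Rightarrow> (nat \<Rightarrow> 's) \<Rightarrow> ennreal" where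
  "partial_weight M NT n f m y z = marg_y M NT (n 1) (f 1) {1..1} y * (\<Prod>j=1..<m. cond_dens M NT f j y z)"

lemma weight_eq_partial_weight: "weight M NT n f = partial_weight M NT n f M"
  by (simp add: weight_def partial_weight_def fun_eq_iff)

lemma partial_weight_Suc:
  "1 \<le> m \<Longrightarrow> partial_weight M NT n f (Suc m) y z = partial_weight M NT n f m y z * cond_dens M NT f m y z"
  by (simp add: partial_weight_def mult.assoc)

lemma cond_dens_restrict_fst:
  assumes "m < k" shows "cond_dens M NT f m (restrict y {1..k}) z = cond_dens M NT f m y z"
proof -
  have "marg_yz M NT (f m) {1..j} (restrict y {1..k}) z' = marg_yz M NT (f m) {1..j} y z'" if "j \<le> k" for j z'
    using marg_yz_restrict[of M NT "f m" "{1..j}" "restrict y {1..k}" z'] marg_yz_restrict[of M NT "f m" "{1..j}" y z']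
    unfolding restrict_restrict_sub[OF that] by simp
  then show ?thesis using assms by (simp add: cond_dens_def)
qed

lemma cond_dens_restrict_snd:
  "m \<le> k \<Longrightarrow> cond_dens M NT f m y (restrict z {1..k}) = cond_dens M NT f m y z"
  by (simp add: cond_dens_def restrict_restrict_sub)

lemma partial_weight_restrict_fst:
  assumes "m \<le> k" "1 \<le> k"
  shows "partial_weight M NT n f m (restrict y {1..k}) z = partial_weight M NT n f m y z"
proof -
  have "marg_y M NT (n 1) (f 1) {1..1} (restrict y {1..k}) = marg_y M NT (n 1) (f 1) {1..1} y"
    using marg_y_restrict[of M NT "n 1" "f 1" "{1..1}" "restrict y {1..k}"] marg_y_restrict[of M NT "n 1" "f 1" "{1..1}" y]
      restrict_restrict_sub[OF assms(2), of y] by simp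
  then show ?thesis
    unfolding partial_weight_def using assms
    by (auto intro!: arg_cong2[where f="(*)"] prod.cong simp: cond_dens_restrict_fst)
qed

lemma partial_weight_restrict_snd:
  assumes "m \<le> Suc k"
  shows "partial_weight M NT n f m y (restrict z {1..k}) = partial_weight M NT n f m y z"
  unfolding partial_weight_def using assms
  by (auto intro!: arg_cong2[where f="(*)"] prod.cong simp: cond_dens_restrict_snd)

lemma partial_weight_update_fst:
  assumes "1 \<le> m"
  shows "partial_weight M NT n f m (y(Suc m := t)) z = partial_weight M NT n f m y z"
  using partial_weight_restrict_fst[of m m M NT n f "y(Suc m := t)" z] partial_weight_restrict_fst[of m m M NT n f y z] assms
  by (simp add: restrict_update)

lemma partial_weight_update_snd:
  "partial_weight M NT n f (Suc m) y (z(Suc m := x)) = partial_weight M NT n f (Suc m) y z"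
  using partial_weight_restrict_snd[of "Suc m" m M NT n f y "z(Suc m := x)"] partial_weight_restrict_snd[of "Suc m" m M NT n f y z]
  by (simp add: restrict_update)

text \<open>The assumptions on the joint law of observations and states and on the simulation kernels; the
  random sample enters only later.\<close>
locale simulation_model = prob_space P for P :: "'w measure" +
  fixes NT :: "'t measure" and M :: nat
    and Z :: "'w \<Rightarrow> nat \<Rightarrow> 's::topological_space" and Y :: "'w \<Rightarrow> nat \<Rightarrow> 't"
    and n :: "nat \<Rightarrow> (nat \<Rightarrow> 's) measure"
    and f :: "nat \<Rightarrow> (nat \<Rightarrow> 't) \<times> (nat \<Rightarrow> 's) \<Rightarrow> ennreal"
    and \<gamma> :: "nat \<Rightarrow> (nat \<Rightarrow> 't) \<times> (nat \<Rightarrow> 's) \<Rightarrow> 's measure"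
  assumes M_pos: "M \<ge> 1"
    and Z [measurable]: "Z \<in> P \<rightarrow>\<^sub>M vec_measure borel M"
    and Y [measurable]: "Y \<in> P \<rightarrow>\<^sub>M vec_measure NT M"
    and sigma_finite_NT: "sigma_finite_measure NT"
    and sigma_finite_n: "\<And>m. m \<in> {1..M} \<Longrightarrow> sigma_finite_measure (n m)"
    and sets_n: "\<And>m. m \<in> {1..M} \<Longrightarrow> sets (n m) = sets (vec_measure borel m)"
    and density: "\<And>m. m \<in> {1..M} \<Longrightarrow>
      distributed P (vec_measure NT M \<Otimes>\<^sub>M n m) (\<lambda>\<omega>. (Y \<omega>, restrict (Z \<omega>) {1..m})) (f m)"
    and simulation_kernel: "\<And>m. m \<in> {1..M} \<Longrightarrow>
      reg_cond_dist P (\<lambda>\<omega>. Z \<omega> m) borel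
        (\<lambda>\<omega>. (restrict (Y \<omega>) {1..m}, restrict (Z \<omega>) {1..m-1}))
        (vec_measure NT m \<Otimes>\<^sub>M vec_measure borel (m-1)) (\<gamma> m)"
begin

sublocale T: product_sigma_finite "\<lambda>_::nat. NT"
  by (intro product_sigma_finite.intro sigma_finite_NT)

abbreviation T where "T k \<equiv> vec_measure NT k"
abbreviation V where "V k \<equiv> vec_measure (borel :: 's measure) k"
abbreviation marg where "marg m k \<equiv> marg_yz M NT (f m) {1..k}"
abbreviation wt where "wt \<equiv> partial_weight M NT n f"

lemma sigma_finite_T: "finite I \<Longrightarrow> sigma_finite_measure (PiM I (\<lambda>_::nat. NT))"
  by (rule T.sigma_finite)

lemma space_n: "m \<in> {1..M} \<Longrightarrow> space (n m) = space (V m)"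
  by (rule sets_eq_imp_space_eq[OF sets_n])

lemma measurable_f [measurable]:
  assumes "m \<in> {1..M}" shows "f m \<in> borel_measurable (T M \<Otimes>\<^sub>M V m)"
  using distributed_borel_measurable[OF density[OF assms]] sets_n[OF assms]
  by (simp cong: measurable_cong_sets sets_pair_measure_cong)

lemma union_split: "k \<le> M \<Longrightarrow> {1..k} \<union> ({1..M} - {1..k}) = {1..M}"
  by auto

lemma measurable_merge_T:
  assumes "k \<le> M"
  shows "merge {1..k} ({1..M} - {1..k}) \<in> T k \<Otimes>\<^sub>M PiM ({1..M} - {1..k}) (\<lambda>_. NT) \<rightarrow>\<^sub>M T M"
  using measurable_merge[of "{1..k}" "{1..M} - {1..k}" "\<lambda>_. NT"] unfolding union_split[OF assms] .

lemma measurable_marg: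
  assumes m: "m \<in> {1..M}" and k: "k \<le> M"
  shows "(\<lambda>(y, z). marg m k y z) \<in> borel_measurable (T k \<Otimes>\<^sub>M V m)"
proof -
  interpret R: sigma_finite_measure "PiM ({1..M} - {1..k}) (\<lambda>_. NT)"
    by (rule sigma_finite_T) simp
  note [measurable] = measurable_merge_T[OF k] measurable_f[OF m]
  show ?thesis
    unfolding marg_yz_def case_prod_beta'
    by (rule R.borel_measurable_nn_integral) measurable
qed

lemma measurable_marg' [measurable (raw)]:
  assumes "m \<in> {1..M}" "k \<le> M" "a \<in> L \<rightarrow>\<^sub>M T k" "b \<in> L \<rightarrow>\<^sub>M V m"
  shows "(\<lambda>x. marg m k (a x) (b x)) \<in> borel_measurable L"
  using measurable_compose[OF measurable_Pair[OF assms(3,4)] measurable_marg[OF assms(1,2)]] by simp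

lemma measurable_cond_dens:
  assumes m: "m \<in> {1..<M}" and k: "m < k" and l: "m \<le> l"
  shows "(\<lambda>(y, z). cond_dens M NT f m y z) \<in> borel_measurable (T k \<Otimes>\<^sub>M V l)"
proof -
  have [measurable]: "(\<lambda>y. restrict y {1..j}) \<in> T k \<rightarrow>\<^sub>M T j" if "j \<le> Suc m" for j
    using k that by (intro measurable_vec_restrict) auto
  have [measurable]: "(\<lambda>z. restrict z {1..m}) \<in> V l \<rightarrow>\<^sub>M V m"
    using l by (rule measurable_vec_restrict)
  have "(\<lambda>p. marg m (m + 1) (restrict (fst p) {1..m+1}) (restrict (snd p) {1..m})
      / marg m m (restrict (fst p) {1..m}) (restrict (snd p) {1..m})) \<in> borel_measurable (T k \<Otimes>\<^sub>M V l)"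
    using m by (intro borel_measurable_divide_ennreal measurable_marg') measurable
  then show ?thesis
    by (simp add: cond_dens_def case_prod_beta' marg_yz_restrict)
qed

lemma measurable_marg_y:
  assumes m: "m \<in> {1..M}" and k: "k \<le> M"
  shows "marg_y M NT (n m) (f m) {1..k} \<in> borel_measurable (T k)"
proof -
  interpret sigma_finite_measure "n m" by (rule sigma_finite_n[OF m])
  have "(\<lambda>(y, z). marg m k y z) \<in> borel_measurable (T k \<Otimes>\<^sub>M n m)"
    using measurable_marg[OF m k] sets_n[OF m] by (simp cong: measurable_cong_sets sets_pair_measure_cong)
  then show ?thesis
    unfolding marg_y_def by (intro borel_measurable_nn_integral) auto
qed

lemma measurable_partial_weight:
  assumes m: "m \<le> M" "1 \<le> k" "m \<le> k" "m \<le> Suc l"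
  shows "(\<lambda>(y, z). wt m y z) \<in> borel_measurable (T k \<Otimes>\<^sub>M V l)"
proof -
  have [measurable]: "(\<lambda>y. restrict y {1..1}) \<in> T k \<rightarrow>\<^sub>M T 1"
    using m by (intro measurable_vec_restrict) auto
  have [measurable]: "marg_y M NT (n 1) (f 1) {1..1} \<in> borel_measurable (T 1)"
    using M_pos by (intro measurable_marg_y) auto
  have "(\<lambda>p. marg_y M NT (n 1) (f 1) {1..1} (restrict (fst p) {1..1})) \<in> borel_measurable (T k \<Otimes>\<^sub>M V l)"
    by measurable
  moreover have "(\<lambda>p. \<Prod>j=1..<m. cond_dens M NT f j (fst p) (snd p)) \<in> borel_measurable (T k \<Otimes>\<^sub>M V l)"
    using measurable_cond_dens[of _ k l] m by (intro borel_measurable_prod_ennreal) (auto simp: case_prod_beta')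
  ultimately show ?thesis
    unfolding partial_weight_def marg_y_restrict case_prod_beta' by (rule borel_measurable_times_ennreal)
qed

lemma measurable_gamma:
  assumes "Suc m \<le> M" shows "\<gamma> (Suc m) \<in> T (Suc m) \<Otimes>\<^sub>M V m \<rightarrow>\<^sub>M prob_algebra borel"
  using simulation_kernel[of "Suc m"] assms by (simp add: reg_cond_dist_def)

lemma measurable_sim_step:
  assumes "Suc m \<le> k" "Suc m \<le> M"
  shows "(\<lambda>(y, z). distr (\<gamma> (Suc m) (restrict y {1..Suc m}, z)) (V (Suc m)) (\<lambda>x. z(Suc m := x)))
    \<in> T k \<Otimes>\<^sub>M V m \<rightarrow>\<^sub>M prob_algebra (V (Suc m))"
proof -
  note [measurable] = measurable_vec_restrict[OF assms(1)] measurable_gamma[OF assms(2)] measurable_vec_update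
  show ?thesis
    unfolding case_prod_beta'
  proof (rule measurable_distr_prob_space2)
    show "(\<lambda>p. \<gamma> (Suc m) (restrict (fst p) {1..Suc m}, snd p)) \<in> T k \<Otimes>\<^sub>M V m \<rightarrow>\<^sub>M prob_algebra borel"
      by measurable
    have "(\<lambda>q. (\<lambda>(y, t). y(Suc m := t)) (snd (fst q), snd q)) \<in> (T k \<Otimes>\<^sub>M V m) \<Otimes>\<^sub>M borel \<rightarrow>\<^sub>M V (Suc m)"
      by measurable
    then show "(\<lambda>(p, x). (snd p)(Suc m := x)) \<in> (T k \<Otimes>\<^sub>M V m) \<Otimes>\<^sub>M borel \<rightarrow>\<^sub>M V (Suc m)"
      by (simp add: case_prod_beta')
  qed
qed

lemma measurable_sim_measure:
  "m \<le> k \<Longrightarrow> m \<le> M \<Longrightarrow> sim_measure \<gamma> m \<in> T k \<rightarrow>\<^sub>M prob_algebra (V m)"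
proof (induction m)
  case 0
  have "return (V 0) (\<lambda>_. undefined) \<in> space (prob_algebra (V 0))"
    by (auto simp: space_prob_algebra space_PiM PiE_def intro!: prob_space_return)
  then show ?case by simp
next
  case (Suc m)
  then show ?case
    unfolding sim_measure.simps(2)[abs_def]
    by (intro measurable_bind_prob_space2[OF _ measurable_sim_step]) auto
qed

lemma sim_measure_restrict: "m \<le> k \<Longrightarrow> sim_measure \<gamma> m (restrict y {1..k}) = sim_measure \<gamma> m y"
  by (induction m) (simp_all add: restrict_restrict_sub)

lemma sim_measure_update: "sim_measure \<gamma> m (y(Suc m := t)) = sim_measure \<gamma> m y"
  using sim_measure_restrict[of m m "y(Suc m := t)"] sim_measure_restrict[of m m y] by (simp add: restrict_update)

lemma nn_integral_sim_Suc:
  assumes m: "Suc m \<le> M" and y: "y \<in> space (T (Suc m))" and F [measurable]: "F \<in> borel_measurable (V (Suc m))"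
  shows "(\<integral>\<^sup>+z. F z \<partial>sim_measure \<gamma> (Suc m) y)
    = (\<integral>\<^sup>+z. \<integral>\<^sup>+x. F (z(Suc m := x)) \<partial>\<gamma> (Suc m) (y, z) \<partial>sim_measure \<gamma> m y)"
proof -
  have ks: "sim_measure \<gamma> m \<in> T (Suc m) \<rightarrow>\<^sub>M prob_algebra (V m)"
    using m by (intro measurable_sim_measure) auto
  note sims = prob_algebra_kernel[OF ks y]
  have k: "(\<lambda>z. distr (\<gamma> (Suc m) (restrict y {1..Suc m}, z)) (V (Suc m)) (\<lambda>x. z(Suc m := x)))
      \<in> sim_measure \<gamma> m y \<rightarrow>\<^sub>M subprob_algebra (V (Suc m))"
    using measurable_prob_algebraD[OF measurable_compose[OF measurable_Pair1'[OF y] measurable_sim_step[OF order_refl m]]] sims(2)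
    by (simp cong: measurable_cong_sets)
  show ?thesis
    unfolding sim_measure.simps
  proof (subst nn_integral_bind[OF F k], rule nn_integral_cong)
    fix z assume "z \<in> space (sim_measure \<gamma> m y)"
    then have z: "z \<in> space (V m)" using sims(3) by simp
    have yz: "(y, z) \<in> space (T (Suc m) \<Otimes>\<^sub>M V m)" using y z by (simp add: space_pair_measure)
    have "(\<lambda>x. z(Suc m := x)) \<in> borel \<rightarrow>\<^sub>M V (Suc m)"
      using measurable_compose[OF measurable_Pair1'[OF z] measurable_vec_update] by simp
    then have "(\<lambda>x. z(Suc m := x)) \<in> \<gamma> (Suc m) (y, z) \<rightarrow>\<^sub>M V (Suc m)"
      using prob_algebra_kernel(2)[OF measurable_gamma[OF m] yz] by (simp cong: measurable_cong_sets)
    then show "(\<integral>\<^sup>+x. F x \<partial>distr (\<gamma> (Suc m) (restrict y {1..Suc m}, z)) (V (Suc m)) (\<lambda>x. z(Suc m := x)))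
        = (\<integral>\<^sup>+x. F (z(Suc m := x)) \<partial>\<gamma> (Suc m) (y, z))"
      by (simp add: restrict_space_vec[OF y] nn_integral_distr)
  qed
qed

lemma measurable_on_n:
  "m \<in> {1..M} \<Longrightarrow> F \<in> borel_measurable (L \<Otimes>\<^sub>M V m) \<Longrightarrow> F \<in> borel_measurable (L \<Otimes>\<^sub>M n m)"
  using sets_n by (simp cong: measurable_cong_sets sets_pair_measure_cong)

text \<open>The marginal density is the density of the truncated pair: the superfluous coordinates of \<open>y\<close>
  are split off from the product measure and integrated out.\<close>
lemma nn_integral_marginal:
  assumes m: "m \<in> {1..M}" and k: "k \<le> M" and G: "G \<in> borel_measurable (T k \<Otimes>\<^sub>M V m)"
  shows "(\<integral>\<^sup>+\<omega>. G (restrict (Y \<omega>) {1..k}, restrict (Z \<omega>) {1..m}) \<partial>P)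
    = (\<integral>\<^sup>+z. \<integral>\<^sup>+y. marg m k y z * G (y, z) \<partial>T k \<partial>n m)"
proof -
  interpret n: sigma_finite_measure "n m" by (rule sigma_finite_n[OF m])
  interpret TM: sigma_finite_measure "T M" by (rule sigma_finite_T) simp
  interpret Q: pair_sigma_finite "T M" "n m" by unfold_locales
  note [measurable] = measurable_f[OF m] measurable_vec_restrict[OF k] G measurable_merge_T[OF k]
  let ?G = "\<lambda>p. G (restrict (fst p) {1..k}, snd p)"
  have Gm: "?G \<in> borel_measurable (T M \<Otimes>\<^sub>M n m)"
    by (rule measurable_on_n[OF m]) measurable
  have fm: "f m \<in> borel_measurable (T M \<Otimes>\<^sub>M n m)"
    by (rule measurable_on_n[OF m]) measurable
  have "(\<integral>\<^sup>+\<omega>. G (restrict (Y \<omega>) {1..k}, restrict (Z \<omega>) {1..m}) \<partial>P)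
      = (\<integral>\<^sup>+p. f m p * ?G p \<partial>(T M \<Otimes>\<^sub>M n m))"
    using distributed_nn_integral[OF density[OF m] Gm] by simp
  also have "\<dots> = (\<integral>\<^sup>+z. \<integral>\<^sup>+y. f m (y, z) * G (restrict y {1..k}, z) \<partial>T M \<partial>n m)"
    using fm Gm by (subst Q.nn_integral_snd[symmetric]) auto
  also have "\<dots> = (\<integral>\<^sup>+z. \<integral>\<^sup>+y. marg m k y z * G (y, z) \<partial>T k \<partial>n m)"
  proof (rule nn_integral_cong)
    fix z assume "z \<in> space (n m)"
    then have z: "z \<in> space (V m)" using space_n[OF m] by simp
    have fz: "(\<lambda>y. f m (y, z)) \<in> borel_measurable (T M)"
      using z by measurable
    have "(\<lambda>y. f m (y, z) * G (restrict y {1..k}, z)) \<in> borel_measurable (T M)"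
      using z by measurable
    then have "(\<integral>\<^sup>+y. f m (y, z) * G (restrict y {1..k}, z) \<partial>T M)
      = (\<integral>\<^sup>+y. \<integral>\<^sup>+u. f m (merge {1..k} ({1..M} - {1..k}) (y, u), z)
            * G (restrict (merge {1..k} ({1..M} - {1..k}) (y, u)) {1..k}, z)
          \<partial>PiM ({1..M} - {1..k}) (\<lambda>_. NT) \<partial>T k)"
      using T.product_nn_integral_fold[of "{1..k}" "{1..M} - {1..k}" "\<lambda>y. f m (y, z) * G (restrict y {1..k}, z)"]
      unfolding union_split[OF k] by auto
    also have "\<dots> = (\<integral>\<^sup>+y. marg m k y z * G (y, z) \<partial>T k)"
    proof (rule nn_integral_cong)
      fix y assume y: "y \<in> space (T k)"
      have "merge {1..k} ({1..M} - {1..k}) \<circ> Pair y \<in> PiM ({1..M} - {1..k}) (\<lambda>_. NT) \<rightarrow>\<^sub>M T M"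
        by (rule measurable_comp[OF measurable_Pair1'[OF y] measurable_merge_T[OF k]])
      from measurable_compose[OF this fz]
      have "(\<lambda>u. f m (merge {1..k} ({1..M} - {1..k}) (y, u), z)) \<in> borel_measurable (PiM ({1..M} - {1..k}) (\<lambda>_. NT))"
        by simp
      then show "(\<integral>\<^sup>+u. f m (merge {1..k} ({1..M} - {1..k}) (y, u), z)
            * G (restrict (merge {1..k} ({1..M} - {1..k}) (y, u)) {1..k}, z)
          \<partial>PiM ({1..M} - {1..k}) (\<lambda>_. NT)) = marg m k y z * G (y, z)"
        using restrict_space_vec[OF y]
        by (simp add: marg_yz_def nn_integral_multc)
    qed
    finally show "(\<integral>\<^sup>+y. f m (y, z) * G (restrict y {1..k}, z) \<partial>T M) = (\<integral>\<^sup>+y. marg m k y z * G (y, z) \<partial>T k)" .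
  qed
  finally show ?thesis .
qed

lemma marg_Suc:
  assumes m: "m \<in> {1..M}" and k: "k < M" and y: "y \<in> space (T k)" and z: "z \<in> space (V m)"
  shows "marg m k y z = (\<integral>\<^sup>+t. marg m (Suc k) (y(Suc k := t)) z \<partial>NT)"
proof -
  let ?J = "{1..M} - {1..Suc k}"
  have J: "{1..M} - {1..k} = insert (Suc k) ?J" using k by auto
  have "merge {1..k} ({1..M} - {1..k}) \<circ> Pair y \<in> PiM ({1..M} - {1..k}) (\<lambda>_. NT) \<rightarrow>\<^sub>M T M"
    using k by (intro measurable_comp[OF measurable_Pair1'[OF y] measurable_merge_T]) simp
  moreover have "(\<lambda>y. f m (y, z)) \<in> borel_measurable (T M)"
    using z by (intro measurable_compose[OF measurable_Pair2' measurable_f[OF m]])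
  ultimately have "(\<lambda>u. f m (merge {1..k} ({1..M} - {1..k}) (y, u), z)) \<in> borel_measurable (PiM ({1..M} - {1..k}) (\<lambda>_. NT))"
    by (auto dest: measurable_compose)
  then have "(\<lambda>u. f m (merge {1..k} (insert (Suc k) ?J) (y, u), z)) \<in> borel_measurable (PiM (insert (Suc k) ?J) (\<lambda>_. NT))"
    unfolding J .
  then have "marg m k y z = (\<integral>\<^sup>+t. \<integral>\<^sup>+u. f m (merge {1..k} (insert (Suc k) ?J) (y, u(Suc k := t)), z) \<partial>PiM ?J (\<lambda>_. NT) \<partial>NT)"
    unfolding marg_yz_def J by (subst T.product_nn_integral_insert_rev) auto
  moreover have "merge {1..k} (insert (Suc k) ?J) (y, u(Suc k := t)) = merge {1..Suc k} ?J (y(Suc k := t), u)" for u t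
    using k by (auto simp: merge_def fun_eq_iff)
  ultimately show ?thesis by (simp add: marg_yz_def)
qed

lemma nn_integral_T_Suc:
  assumes "F \<in> borel_measurable (T (Suc k))"
  shows "(\<integral>\<^sup>+y. F y \<partial>T (Suc k)) = (\<integral>\<^sup>+y. \<integral>\<^sup>+t. F (y(Suc k := t)) \<partial>NT \<partial>T k)"
  using assms T.product_nn_integral_insert[of "{1..k}" "Suc k" F]
  by (simp add: atLeastAtMost_insert)

text \<open>The conditional density \<open>r t / q\<close> times the marginal density \<open>q\<close> is the joint density \<open>r t\<close>. Where
  \<open>q = 0\<close> the convention \<open>0 / 0 = 0\<close> is harmless, since \<open>r\<close> then vanishes almost everywhere; \<open>q = \<infinity>\<close>
  has to be excluded.\<close>
lemma density_ratio_integral: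
  fixes q :: ennreal
  assumes q: "q = (\<integral>\<^sup>+t. r t \<partial>NT)" "q < \<infinity>" and [measurable]: "r \<in> borel_measurable NT" "g \<in> borel_measurable NT"
  shows "(\<integral>\<^sup>+t. r t * g t \<partial>NT) = q * (\<integral>\<^sup>+t. r t / q * g t \<partial>NT)"
proof (cases "q = 0")
  case True
  then have "AE t in NT. r t = 0" using q(1) by (simp add: nn_integral_0_iff_AE)
  then have "(\<integral>\<^sup>+t. r t * g t \<partial>NT) = (\<integral>\<^sup>+t. 0 \<partial>NT)"
    by (intro nn_integral_cong_AE) auto
  then show ?thesis using True by simp
next
  case False
  have "q * (r t / q * g t) = r t * g t" for t
  proof -
    have "r t / q * q = r t" using False q(2) by (simp add: ennreal_divide_times)
    then show ?thesis by (metis mult.assoc mult.commute)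
  qed
  then show ?thesis
    by (subst nn_integral_cmult[symmetric]) simp_all
qed

text \<open>Prediction step: given the first \<open>m\<close> observations and states, the next observation has the
  conditional density \<open>cond_dens\<close>.\<close>
lemma nn_integral_predict:
  assumes m: "1 \<le> m" "m < M" and G: "G \<in> borel_measurable (T (Suc m) \<Otimes>\<^sub>M V m)"
  shows "(\<integral>\<^sup>+\<omega>. G (restrict (Y \<omega>) {1..Suc m}, restrict (Z \<omega>) {1..m}) \<partial>P)
    = (\<integral>\<^sup>+\<omega>. \<integral>\<^sup>+t. cond_dens M NT f m ((restrict (Y \<omega>) {1..m})(Suc m := t)) (restrict (Z \<omega>) {1..m})
        * G ((restrict (Y \<omega>) {1..m})(Suc m := t), restrict (Z \<omega>) {1..m}) \<partial>NT \<partial>P)"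
proof -
  have mM: "m \<in> {1..M}" using m by auto
  interpret n: sigma_finite_measure "n m" by (rule sigma_finite_n[OF mM])
  interpret Tm: sigma_finite_measure "T m" by (rule sigma_finite_T) simp
  note [measurable] = G measurable_vec_update measurable_cond_dens[of m "Suc m" m]
  let ?c = "\<lambda>y z t. cond_dens M NT f m (y(Suc m := t)) z"
  have upd: "(\<lambda>x. (fst (fst x))(Suc m := snd x)) \<in> (T m \<Otimes>\<^sub>M V m) \<Otimes>\<^sub>M NT \<rightarrow>\<^sub>M T (Suc m)"
    using measurable_compose[OF _ measurable_vec_update, of "\<lambda>x. (fst (fst x), snd x)" "(T m \<Otimes>\<^sub>M V m) \<Otimes>\<^sub>M NT" m NT]
    by simp
  have c: "(\<lambda>x. cond_dens M NT f m ((fst (fst x))(Suc m := snd x)) (snd (fst x)))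
      \<in> borel_measurable ((T m \<Otimes>\<^sub>M V m) \<Otimes>\<^sub>M NT)"
    using measurable_compose[OF measurable_Pair[OF upd measurable_compose[OF measurable_fst measurable_snd]]
      measurable_cond_dens[of m "Suc m" m]] m by simp
  have g: "(\<lambda>x. G ((fst (fst x))(Suc m := snd x), snd (fst x))) \<in> borel_measurable ((T m \<Otimes>\<^sub>M V m) \<Otimes>\<^sub>M NT)"
    using measurable_compose[OF measurable_Pair[OF upd measurable_compose[OF measurable_fst measurable_snd]] G] by simp
  define H where "H p = (\<integral>\<^sup>+t. ?c (fst p) (snd p) t * G ((fst p)(Suc m := t), snd p) \<partial>NT)" for p
  have H: "H \<in> borel_measurable (T m \<Otimes>\<^sub>M V m)"
    unfolding H_def by (rule sigma_finite_measure.borel_measurable_nn_integral[OF sigma_finite_NT]) (use c g in \<open>simp add: case_prod_beta'\<close>)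
  have mm: "(\<lambda>(y, z). marg m m y z) \<in> borel_measurable (T m \<Otimes>\<^sub>M n m)"
    using m by (intro measurable_on_n[OF mM] measurable_marg[OF mM]) simp
  have swap: "(\<lambda>p. marg m m (snd p) (fst p)) \<in> borel_measurable (n m \<Otimes>\<^sub>M T m)"
    using measurable_compose[OF measurable_pair_swap' mm] by (simp add: case_prod_beta')
  have "(\<integral>\<^sup>+z. \<integral>\<^sup>+y. marg m m y z * 1 \<partial>T m \<partial>n m) = 1"
    using nn_integral_marginal[OF mM, of m "\<lambda>_. 1"] m by (simp add: emeasure_space_1)
  \<comment> \<open>A density has total mass one, so the marginal is finite almost everywhere.\<close>
  then have fin: "AE z in n m. (\<integral>\<^sup>+y. marg m m y z \<partial>T m) \<noteq> \<infinity>"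
    using swap by (intro nn_integral_PInf_AE Tm.borel_measurable_nn_integral) (auto simp: case_prod_beta')
  have "(\<integral>\<^sup>+\<omega>. G (restrict (Y \<omega>) {1..Suc m}, restrict (Z \<omega>) {1..m}) \<partial>P)
      = (\<integral>\<^sup>+z. \<integral>\<^sup>+y. marg m (Suc m) y z * G (y, z) \<partial>T (Suc m) \<partial>n m)"
    using m by (intro nn_integral_marginal[OF mM _ G]) simp
  also have "\<dots> = (\<integral>\<^sup>+z. \<integral>\<^sup>+y. marg m m y z * H (y, z) \<partial>T m \<partial>n m)"
  proof (rule nn_integral_cong_AE)
    show "AE z in n m. (\<integral>\<^sup>+y. marg m (Suc m) y z * G (y, z) \<partial>T (Suc m))
        = (\<integral>\<^sup>+y. marg m m y z * H (y, z) \<partial>T m)"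
      using fin AE_space
    proof eventually_elim
      case (elim z)
      then have z: "z \<in> space (V m)" using space_n[OF mM] by simp
      have Pz: "(\<lambda>y. (y, z)) \<in> T k \<rightarrow>\<^sub>M T k \<Otimes>\<^sub>M V m" for k using z by simp
      have mz: "(\<lambda>y. marg m k y z) \<in> borel_measurable (T k)" if "k \<le> M" for k
        using measurable_compose[OF Pz measurable_marg[OF mM that]] by simp
      have gz: "(\<lambda>y. G (y, z)) \<in> borel_measurable (T (Suc m))"
        by (rule measurable_compose[OF Pz G])
      have fin_y: "AE y in T m. marg m m y z \<noteq> \<infinity>"
        using elim mz[of m] m by (intro nn_integral_PInf_AE) auto
      have "(\<integral>\<^sup>+y. marg m (Suc m) y z * G (y, z) \<partial>T (Suc m))
          = (\<integral>\<^sup>+y. \<integral>\<^sup>+t. marg m (Suc m) (y(Suc m := t)) z * G (y(Suc m := t), z) \<partial>NT \<partial>T m)"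
        using mz[of "Suc m"] gz m by (intro nn_integral_T_Suc borel_measurable_times_ennreal) auto
      also have "\<dots> = (\<integral>\<^sup>+y. marg m m y z * H (y, z) \<partial>T m)"
      proof (rule nn_integral_cong_AE)
        show "AE y in T m. (\<integral>\<^sup>+t. marg m (Suc m) (y(Suc m := t)) z * G (y(Suc m := t), z) \<partial>NT) = marg m m y z * H (y, z)"
          using fin_y AE_space
        proof eventually_elim
          case (elim y)
          have uy: "(\<lambda>t. y(Suc m := t)) \<in> NT \<rightarrow>\<^sub>M T (Suc m)"
            using measurable_compose[OF measurable_Pair1'[OF elim(2)] measurable_vec_update] by simp
          have cd: "?c y z t = marg m (Suc m) (y(Suc m := t)) z / marg m m y z" for t
            using marg_yz_restrict[of M NT "f m" "{1..m}" "y(Suc m := t)" z] marg_yz_restrict[of M NT "f m" "{1..m}" y z]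
            by (simp add: cond_dens_def restrict_space_vec[OF z] restrict_update flip: Suc_eq_plus1)
          show ?case
            unfolding H_def fst_conv snd_conv cd
          proof (rule density_ratio_integral)
            show "marg m m y z = (\<integral>\<^sup>+t. marg m (Suc m) (y(Suc m := t)) z \<partial>NT)"
              using marg_Suc[OF mM m(2) elim(2) z] .
            show "marg m m y z < \<infinity>" using elim(1) by (simp add: top.not_eq_extremum)
            show "(\<lambda>t. marg m (Suc m) (y(Suc m := t)) z) \<in> borel_measurable NT"
              using m by (intro measurable_compose[OF uy mz]) simp
            show "(\<lambda>t. G (y(Suc m := t), z)) \<in> borel_measurable NT"
              by (rule measurable_compose[OF uy gz])
          qed
        qed
      qed
      finally show ?case .
    qed
  qed
  also have "\<dots> = (\<integral>\<^sup>+\<omega>. H (restrict (Y \<omega>) {1..m}, restrict (Z \<omega>) {1..m}) \<partial>P)"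
    using m by (intro nn_integral_marginal[OF mM _ H, symmetric]) simp
  finally show ?thesis by (simp add: H_def)
qed

text \<open>The two forms of the importance sampling identity that the induction alternates between, as in a
  particle filter: \<open>predicts m\<close> for \<open>m + 1\<close> observations and \<open>m\<close> states, \<open>filters m\<close> for \<open>m\<close> of
  each.\<close>
definition predicts :: "nat \<Rightarrow> bool" where
  "predicts m \<longleftrightarrow> (\<forall>G \<in> borel_measurable (T (Suc m) \<Otimes>\<^sub>M V m).
    (\<integral>\<^sup>+\<omega>. G (restrict (Y \<omega>) {1..Suc m}, restrict (Z \<omega>) {1..m}) \<partial>P)
    = (\<integral>\<^sup>+y. \<integral>\<^sup>+z. wt (Suc m) y z * G (y, z) \<partial>sim_measure \<gamma> m y \<partial>T (Suc m)))"

definition filters :: "nat \<Rightarrow> bool" where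
  "filters m \<longleftrightarrow> (\<forall>F \<in> borel_measurable (T m \<Otimes>\<^sub>M V m).
    (\<integral>\<^sup>+\<omega>. F (restrict (Y \<omega>) {1..m}, restrict (Z \<omega>) {1..m}) \<partial>P)
    = (\<integral>\<^sup>+y. \<integral>\<^sup>+z. wt m y z * F (y, z) \<partial>sim_measure \<gamma> m y \<partial>T m))"

text \<open>With no states, the claim is that \<open>f\<^sub>1(y\<^sub>1)\<close> is the density of \<open>Y\<^sub>1\<close>.\<close>
lemma predicts_0: "predicts 0"
  unfolding predicts_def
proof
  fix G :: "(nat \<Rightarrow> 't) \<times> (nat \<Rightarrow> 's) \<Rightarrow> ennreal"
  assume G: "G \<in> borel_measurable (T (Suc 0) \<Otimes>\<^sub>M V 0)"
  let ?u = "\<lambda>_::nat. undefined :: 's"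
  have one: "1 \<in> {1..M}" using M_pos by simp
  interpret n: sigma_finite_measure "n 1" by (rule sigma_finite_n[OF one])
  interpret T1: sigma_finite_measure "T 1" by (rule sigma_finite_T) simp
  interpret Q: pair_sigma_finite "T 1" "n 1" by unfold_locales
  have u: "?u \<in> space (V 0)" by (simp add: space_PiM)
  have Gu: "(\<lambda>y. G (y, ?u)) \<in> borel_measurable (T 1)"
    using measurable_compose[OF measurable_Pair2'[OF u] G] by (simp add: One_nat_def)
  have m1: "(\<lambda>(y, z). marg 1 1 y z) \<in> borel_measurable (T 1 \<Otimes>\<^sub>M n 1)"
    by (rule measurable_on_n[OF one measurable_marg[OF one M_pos]])
  have m2: "(\<lambda>z. marg 1 1 y z) \<in> borel_measurable (n 1)" if "y \<in> space (T 1)" for y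
    using measurable_compose[OF measurable_Pair1'[OF that] m1] by simp
  have m3: "(\<lambda>(y, z). marg 1 1 y z * G (y, ?u)) \<in> borel_measurable (T 1 \<Otimes>\<^sub>M n 1)"
    using borel_measurable_times_ennreal[OF m1 measurable_compose[OF measurable_fst Gu]] by (simp add: case_prod_beta')
  have "(\<integral>\<^sup>+\<omega>. G (restrict (Y \<omega>) {1..Suc 0}, restrict (Z \<omega>) {1..0}) \<partial>P)
      = (\<integral>\<^sup>+\<omega>. (\<lambda>(y, z). G (y, ?u)) (restrict (Y \<omega>) {1..1}, restrict (Z \<omega>) {1..1}) \<partial>P)"
    by (simp add: One_nat_def restrict_def)
  also have "\<dots> = (\<integral>\<^sup>+z. \<integral>\<^sup>+y. marg 1 1 y z * (\<lambda>(y, z). G (y, ?u)) (y, z) \<partial>T 1 \<partial>n 1)"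
    using M_pos by (intro nn_integral_marginal[OF one])
      (use measurable_compose[OF measurable_fst Gu] in \<open>auto simp: case_prod_beta'\<close>)
  also have "\<dots> = (\<integral>\<^sup>+z. \<integral>\<^sup>+y. marg 1 1 y z * G (y, ?u) \<partial>T 1 \<partial>n 1)" by simp
  also have "\<dots> = (\<integral>\<^sup>+y. \<integral>\<^sup>+z. marg 1 1 y z * G (y, ?u) \<partial>n 1 \<partial>T 1)"
    by (rule Q.Fubini'[OF m3])
  also have "\<dots> = (\<integral>\<^sup>+y. marg_y M NT (n 1) (f 1) {1..1} y * G (y, ?u) \<partial>T 1)"
    by (intro nn_integral_cong, unfold marg_y_def, intro nn_integral_multc m2)
  also have "\<dots> = (\<integral>\<^sup>+y. \<integral>\<^sup>+z. wt 1 y z * G (y, z) \<partial>sim_measure \<gamma> 0 y \<partial>T 1)"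
  proof (rule nn_integral_cong)
    fix y assume y: "y \<in> space (T 1)"
    have "(\<lambda>z. wt 1 y z) \<in> borel_measurable (V 0)"
      using measurable_compose[OF measurable_Pair1'[OF y] measurable_partial_weight[of 1 1 0]] M_pos by simp
    moreover have "(\<lambda>z. G (y, z)) \<in> borel_measurable (V 0)"
      using measurable_compose[OF measurable_Pair1'[OF y] G[folded One_nat_def]] .
    ultimately have "(\<lambda>z. wt 1 y z * G (y, z)) \<in> borel_measurable (V 0)"
      by (rule borel_measurable_times_ennreal)
    then show "marg_y M NT (n 1) (f 1) {1..1} y * G (y, ?u)
        = (\<integral>\<^sup>+z. wt 1 y z * G (y, z) \<partial>sim_measure \<gamma> 0 y)"
      using u by (simp add: nn_integral_return partial_weight_def)
  qed
  finally show "(\<integral>\<^sup>+\<omega>. G (restrict (Y \<omega>) {1..Suc 0}, restrict (Z \<omega>) {1..0}) \<partial>P)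
    = (\<integral>\<^sup>+y. \<integral>\<^sup>+z. wt (Suc 0) y z * G (y, z) \<partial>sim_measure \<gamma> 0 y \<partial>T (Suc 0))"
    by (simp only: One_nat_def)
qed

text \<open>The simulation kernel is the conditional law of the next state, and the weight up to index
  \<open>m + 1\<close> ignores that state, so one step of the simulation extends the identity.\<close>
lemma predicts_imp_filters:
  assumes m: "Suc m \<le> M" and "predicts m"
  shows "filters (Suc m)"
  unfolding filters_def
proof
  fix F :: "(nat \<Rightarrow> 't) \<times> (nat \<Rightarrow> 's) \<Rightarrow> ennreal"
  assume F: "F \<in> borel_measurable (T (Suc m) \<Otimes>\<^sub>M V (Suc m))"
  let ?L = "T (Suc m) \<Otimes>\<^sub>M V m"
  have upd: "(\<lambda>q. (snd (fst q))(Suc m := snd q)) \<in> ?L \<Otimes>\<^sub>M borel \<rightarrow>\<^sub>M V (Suc m)"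
    using measurable_compose[OF _ measurable_vec_update, of "\<lambda>q. (snd (fst q), snd q)" "?L \<Otimes>\<^sub>M borel" m borel] by simp
  have F1: "(\<lambda>q. F (fst (fst q), (snd (fst q))(Suc m := snd q))) \<in> borel_measurable (?L \<Otimes>\<^sub>M borel)"
    by (rule measurable_compose[OF measurable_Pair[OF _ upd] F]) simp
  define G where "G p = (\<integral>\<^sup>+x. F (fst p, (snd p)(Suc m := x)) \<partial>\<gamma> (Suc m) p)" for p
  have G: "G \<in> borel_measurable ?L"
    unfolding G_def
    by (rule nn_integral_measurable_subprob_algebra2[OF _ measurable_prob_algebraD[OF measurable_gamma[OF m]]])
       (use F1 in \<open>simp add: case_prod_beta'\<close>)
  have last: "restrict (Z \<omega>) {1..Suc m} = (restrict (Z \<omega>) {1..m})(Suc m := Z \<omega> (Suc m))" for \<omega>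
    by (auto simp: fun_eq_iff)
  have "(\<integral>\<^sup>+\<omega>. F (restrict (Y \<omega>) {1..Suc m}, restrict (Z \<omega>) {1..Suc m}) \<partial>P)
      = (\<integral>\<^sup>+\<omega>. (\<lambda>q. F (fst (fst q), (snd (fst q))(Suc m := snd q)))
          ((restrict (Y \<omega>) {1..Suc m}, restrict (Z \<omega>) {1..m}), Z \<omega> (Suc m)) \<partial>P)"
    unfolding last by simp
  also have "\<dots> = (\<integral>\<^sup>+\<omega>. G (restrict (Y \<omega>) {1..Suc m}, restrict (Z \<omega>) {1..m}) \<partial>P)"
    using simulation_kernel[of "Suc m"] m F1
    by (subst nn_integral_reg_cond_dist[OF prob_space_axioms, where \<kappa>="\<gamma> (Suc m)" and L="?L" and N=borel])
       (simp_all add: G_def)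
  also have "\<dots> = (\<integral>\<^sup>+y. \<integral>\<^sup>+z. wt (Suc m) y z * G (y, z) \<partial>sim_measure \<gamma> m y \<partial>T (Suc m))"
    using assms(2) G unfolding predicts_def by blast
  also have "\<dots> = (\<integral>\<^sup>+y. \<integral>\<^sup>+z. wt (Suc m) y z * F (y, z) \<partial>sim_measure \<gamma> (Suc m) y \<partial>T (Suc m))"
  proof (rule nn_integral_cong)
    fix y assume y: "y \<in> space (T (Suc m))"
    have ks: "sim_measure \<gamma> m \<in> T (Suc m) \<rightarrow>\<^sub>M prob_algebra (V m)"
      using m by (intro measurable_sim_measure) auto
    have "(\<lambda>z. wt (Suc m) y z * F (y, z)) \<in> borel_measurable (V (Suc m))"
      using measurable_compose[OF measurable_Pair1'[OF y] measurable_partial_weight[of "Suc m" "Suc m" "Suc m"]] m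
        measurable_compose[OF measurable_Pair1'[OF y] F]
      by (intro borel_measurable_times_ennreal) auto
    note nn_integral_sim_Suc[OF m y this]
    moreover have "(\<integral>\<^sup>+x. wt (Suc m) y (z(Suc m := x)) * F (y, z(Suc m := x)) \<partial>\<gamma> (Suc m) (y, z))
        = wt (Suc m) y z * G (y, z)" if "z \<in> space (sim_measure \<gamma> m y)" for z
    proof -
      have yz: "(y, z) \<in> space ?L"
        using that y prob_algebra_kernel(3)[OF ks y] by (simp add: space_pair_measure)
      have "(\<lambda>x. F (y, z(Suc m := x))) \<in> borel_measurable borel"
        using measurable_compose[OF measurable_Pair1'[OF yz] F1] by simp
      then have "(\<lambda>x. F (y, z(Suc m := x))) \<in> borel_measurable (\<gamma> (Suc m) (y, z))"
        using prob_algebra_kernel(2)[OF measurable_gamma[OF m] yz] by (simp cong: measurable_cong_sets)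
      then show ?thesis
        unfolding partial_weight_update_snd G_def by (simp add: nn_integral_cmult)
    qed
    ultimately show "(\<integral>\<^sup>+z. wt (Suc m) y z * G (y, z) \<partial>sim_measure \<gamma> m y)
        = (\<integral>\<^sup>+z. wt (Suc m) y z * F (y, z) \<partial>sim_measure \<gamma> (Suc m) y)"
      by (simp cong: nn_integral_cong)
  qed
  finally show "(\<integral>\<^sup>+\<omega>. F (restrict (Y \<omega>) {1..Suc m}, restrict (Z \<omega>) {1..Suc m}) \<partial>P)
    = (\<integral>\<^sup>+y. \<integral>\<^sup>+z. wt (Suc m) y z * F (y, z) \<partial>sim_measure \<gamma> (Suc m) y \<partial>T (Suc m))" .
qed

text \<open>The conditional density of the next observation is precisely the next factor of the weight.
  The simulated states do not depend on this observation, which allows to exchange the integrals.\<close>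
lemma filters_imp_predicts:
  assumes m: "1 \<le> m" "m < M" and "filters m"
  shows "predicts m"
  unfolding predicts_def
proof
  fix G :: "(nat \<Rightarrow> 't) \<times> (nat \<Rightarrow> 's) \<Rightarrow> ennreal"
  assume G: "G \<in> borel_measurable (T (Suc m) \<Otimes>\<^sub>M V m)"
  have mM: "m \<in> {1..M}" using m by auto
  let ?c = "\<lambda>y z. cond_dens M NT f m y z"
  define C where "C p = ?c (fst p) (snd p) * G p" for p
  have C: "C \<in> borel_measurable (T (Suc m) \<Otimes>\<^sub>M V m)"
    unfolding C_def using measurable_cond_dens[of m "Suc m" m] m G
    by (intro borel_measurable_times_ennreal) (auto simp: case_prod_beta')
  have upd: "(\<lambda>q. (fst (fst q))(Suc m := snd q)) \<in> (T m \<Otimes>\<^sub>M V m) \<Otimes>\<^sub>M NT \<rightarrow>\<^sub>M T (Suc m)"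
    using measurable_compose[OF _ measurable_vec_update, of "\<lambda>q. (fst (fst q), snd q)" "(T m \<Otimes>\<^sub>M V m) \<Otimes>\<^sub>M NT" m NT] by simp
  have C1: "(\<lambda>q. C ((fst (fst q))(Suc m := snd q), snd (fst q))) \<in> borel_measurable ((T m \<Otimes>\<^sub>M V m) \<Otimes>\<^sub>M NT)"
    by (rule measurable_compose[OF measurable_Pair[OF upd] C]) simp
  define H where "H p = (\<integral>\<^sup>+t. C ((fst p)(Suc m := t), snd p) \<partial>NT)" for p
  have H: "H \<in> borel_measurable (T m \<Otimes>\<^sub>M V m)"
    unfolding H_def
    by (rule sigma_finite_measure.borel_measurable_nn_integral[OF sigma_finite_NT])
       (use C1 in \<open>simp add: case_prod_beta'\<close>)
  define \<Phi> where "\<Phi> y = (\<integral>\<^sup>+z. wt (Suc m) y z * G (y, z) \<partial>sim_measure \<gamma> m y)" for y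
  have ks: "sim_measure \<gamma> m \<in> T (Suc m) \<rightarrow>\<^sub>M prob_algebra (V m)" "sim_measure \<gamma> m \<in> T m \<rightarrow>\<^sub>M prob_algebra (V m)"
    using m by (auto intro!: measurable_sim_measure)
  have wG: "(\<lambda>p. wt (Suc m) (fst p) (snd p) * G p) \<in> borel_measurable (T (Suc m) \<Otimes>\<^sub>M V m)"
    using measurable_partial_weight[of "Suc m" "Suc m" m] m G
    by (intro borel_measurable_times_ennreal) (auto simp: case_prod_beta')
  have \<Phi>: "\<Phi> \<in> borel_measurable (T (Suc m))"
    unfolding \<Phi>_def
    by (rule nn_integral_measurable_subprob_algebra2[OF _ measurable_prob_algebraD[OF ks(1)]])
       (use wG in \<open>simp add: case_prod_beta'\<close>)
  have "(\<integral>\<^sup>+\<omega>. G (restrict (Y \<omega>) {1..Suc m}, restrict (Z \<omega>) {1..m}) \<partial>P)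
      = (\<integral>\<^sup>+\<omega>. H (restrict (Y \<omega>) {1..m}, restrict (Z \<omega>) {1..m}) \<partial>P)"
    unfolding nn_integral_predict[OF m G] by (simp add: H_def C_def)
  also have "\<dots> = (\<integral>\<^sup>+y. \<integral>\<^sup>+z. wt m y z * H (y, z) \<partial>sim_measure \<gamma> m y \<partial>T m)"
    using assms(3) H unfolding filters_def by blast
  also have "\<dots> = (\<integral>\<^sup>+y. \<integral>\<^sup>+t. \<Phi> (y(Suc m := t)) \<partial>NT \<partial>T m)"
  proof (rule nn_integral_cong)
    fix y assume y: "y \<in> space (T m)"
    let ?\<mu> = "sim_measure \<gamma> m y"
    note sims = prob_algebra_kernel[OF ks(2) y]
    interpret \<mu>: prob_space ?\<mu> by (rule sims(1))
    interpret Q: pair_sigma_finite ?\<mu> NT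
      using sigma_finite_NT by (intro pair_sigma_finite.intro) unfold_locales
    have w: "(\<lambda>z. wt m y z) \<in> borel_measurable (V m)"
      using measurable_compose[OF measurable_Pair1'[OF y] measurable_partial_weight[of m m m]] m by simp
    have "(\<lambda>p. ((y, fst p), snd p)) \<in> V m \<Otimes>\<^sub>M NT \<rightarrow>\<^sub>M (T m \<Otimes>\<^sub>M V m) \<Otimes>\<^sub>M NT"
      using y by measurable
    from measurable_compose[OF this C1]
    have Cy: "(\<lambda>p. C (y(Suc m := snd p), fst p)) \<in> borel_measurable (V m \<Otimes>\<^sub>M NT)" by simp
    have sets_eq: "sets (?\<mu> \<Otimes>\<^sub>M NT) = sets (V m \<Otimes>\<^sub>M NT)" by (intro sets_pair_measure_cong sims(2) refl)
    have wC: "(\<lambda>(z, t). wt m y z * C (y(Suc m := t), z)) \<in> borel_measurable (?\<mu> \<Otimes>\<^sub>M NT)"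
      unfolding measurable_cong_sets[OF sets_eq refl] case_prod_beta'
      by (intro borel_measurable_times_ennreal Cy measurable_compose[OF measurable_fst w])
    have "(\<integral>\<^sup>+z. wt m y z * H (y, z) \<partial>?\<mu>) = (\<integral>\<^sup>+z. \<integral>\<^sup>+t. wt m y z * C (y(Suc m := t), z) \<partial>NT \<partial>?\<mu>)"
    proof (rule nn_integral_cong)
      fix z assume "z \<in> space ?\<mu>"
      then have "(\<lambda>t. C (y(Suc m := t), z)) \<in> borel_measurable NT"
        using measurable_compose[OF measurable_Pair1' Cy, of z] sims(3) by simp
      then show "wt m y z * H (y, z) = (\<integral>\<^sup>+t. wt m y z * C (y(Suc m := t), z) \<partial>NT)"
        by (simp add: H_def nn_integral_cmult)
    qed
    also have "\<dots> = (\<integral>\<^sup>+t. \<integral>\<^sup>+z. wt m y z * C (y(Suc m := t), z) \<partial>?\<mu> \<partial>NT)"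
      by (rule Q.Fubini'[OF wC, symmetric])
    also have "\<dots> = (\<integral>\<^sup>+t. \<Phi> (y(Suc m := t)) \<partial>NT)"
      using m by (simp add: \<Phi>_def C_def sim_measure_update partial_weight_Suc partial_weight_update_fst mult.assoc)
    finally show "(\<integral>\<^sup>+z. wt m y z * H (y, z) \<partial>?\<mu>) = (\<integral>\<^sup>+t. \<Phi> (y(Suc m := t)) \<partial>NT)" .
  qed
  also have "\<dots> = (\<integral>\<^sup>+y. \<Phi> y \<partial>T (Suc m))"
    by (rule nn_integral_T_Suc[OF \<Phi>, symmetric])
  finally show "(\<integral>\<^sup>+\<omega>. G (restrict (Y \<omega>) {1..Suc m}, restrict (Z \<omega>) {1..m}) \<partial>P)
    = (\<integral>\<^sup>+y. \<integral>\<^sup>+z. wt (Suc m) y z * G (y, z) \<partial>sim_measure \<gamma> m y \<partial>T (Suc m))"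
    by (simp add: \<Phi>_def)
qed

lemma filters_all: "Suc m \<le> M \<Longrightarrow> filters (Suc m)"
proof (induction m)
  case 0
  then show ?case by (intro predicts_imp_filters predicts_0)
next
  case (Suc m)
  then have "predicts (Suc m)" by (intro filters_imp_predicts) auto
  with Suc.prems show ?case by (rule predicts_imp_filters)
qed

theorem nn_integral_importance_sampling:
  assumes F: "F \<in> borel_measurable (T M \<Otimes>\<^sub>M V M)"
  shows "(\<integral>\<^sup>+\<omega>. F (Y \<omega>, Z \<omega>) \<partial>P)
    = (\<integral>\<^sup>+y. \<integral>\<^sup>+z. weight M NT n f y z * F (y, z) \<partial>sim_measure \<gamma> M y \<partial>T M)"
proof -
  obtain m where m: "M = Suc m" using M_pos by (cases M) auto
  have "filters M" using filters_all[of m] m by simp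
  then have "(\<integral>\<^sup>+\<omega>. F (restrict (Y \<omega>) {1..M}, restrict (Z \<omega>) {1..M}) \<partial>P)
    = (\<integral>\<^sup>+y. \<integral>\<^sup>+z. weight M NT n f y z * F (y, z) \<partial>sim_measure \<gamma> M y \<partial>T M)"
    using F by (simp add: filters_def weight_eq_partial_weight)
  moreover have "(\<integral>\<^sup>+\<omega>. F (restrict (Y \<omega>) {1..M}, restrict (Z \<omega>) {1..M}) \<partial>P) = (\<integral>\<^sup>+\<omega>. F (Y \<omega>, Z \<omega>) \<partial>P)"
    by (intro nn_integral_cong) (simp add: restrict_space_vec[OF measurable_space[OF Y]] restrict_space_vec[OF measurable_space[OF Z]])
  ultimately show ?thesis by simp
qed

text \<open>The density \<open>f\<^sub>M(y)\<close> of the observations.\<close>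
abbreviation evidence where "evidence \<equiv> marg_y M NT (n M) (f M) {1..M}"

lemma measurable_evidence: "evidence \<in> borel_measurable (T M)"
  using M_pos by (intro measurable_marg_y) auto

lemma measurable_weight: "(\<lambda>(y, z). weight M NT n f y z) \<in> borel_measurable (T M \<Otimes>\<^sub>M V M)"
  unfolding weight_eq_partial_weight using M_pos by (intro measurable_partial_weight) auto

lemma nn_integral_evidence:
  assumes B: "B \<in> borel_measurable (T M)"
  shows "(\<integral>\<^sup>+\<omega>. B (Y \<omega>) \<partial>P) = (\<integral>\<^sup>+y. evidence y * B y \<partial>T M)"
proof -
  have M: "M \<in> {1..M}" using M_pos by simp
  interpret n: sigma_finite_measure "n M" by (rule sigma_finite_n[OF M])
  interpret TM: sigma_finite_measure "T M" by (rule sigma_finite_T) simp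
  interpret Q: pair_sigma_finite "T M" "n M" by unfold_locales
  have m1: "(\<lambda>(y, z). marg M M y z) \<in> borel_measurable (T M \<Otimes>\<^sub>M n M)"
    by (rule measurable_on_n[OF M measurable_marg[OF M order_refl]])
  have m2: "(\<lambda>z. marg M M y z) \<in> borel_measurable (n M)" if "y \<in> space (T M)" for y
    using measurable_compose[OF measurable_Pair1'[OF that] m1] by simp
  have m3: "(\<lambda>(y, z). marg M M y z * B y) \<in> borel_measurable (T M \<Otimes>\<^sub>M n M)"
    using borel_measurable_times_ennreal[OF m1 measurable_compose[OF measurable_fst B]] by (simp add: case_prod_beta')
  have "(\<integral>\<^sup>+\<omega>. B (Y \<omega>) \<partial>P) = (\<integral>\<^sup>+\<omega>. (\<lambda>p. B (fst p)) (restrict (Y \<omega>) {1..M}, restrict (Z \<omega>) {1..M}) \<partial>P)"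
    by (intro nn_integral_cong) (simp add: restrict_space_vec[OF measurable_space[OF Y]])
  also have "\<dots> = (\<integral>\<^sup>+z. \<integral>\<^sup>+y. marg M M y z * (\<lambda>p. B (fst p)) (y, z) \<partial>T M \<partial>n M)"
    by (rule nn_integral_marginal[OF M order_refl measurable_compose[OF measurable_fst B]])
  also have "\<dots> = (\<integral>\<^sup>+z. \<integral>\<^sup>+y. marg M M y z * B y \<partial>T M \<partial>n M)" by simp
  also have "\<dots> = (\<integral>\<^sup>+y. \<integral>\<^sup>+z. marg M M y z * B y \<partial>n M \<partial>T M)"
    by (rule Q.Fubini'[OF m3])
  also have "\<dots> = (\<integral>\<^sup>+y. evidence y * B y \<partial>T M)"
    by (intro nn_integral_cong, unfold marg_y_def, intro nn_integral_multc m2)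
  finally show ?thesis .
qed

lemma AE_Y_iff:
  assumes Q: "Measurable.pred (T M) Q"
  shows "(AE \<omega> in P. Q (Y \<omega>)) \<longleftrightarrow> (AE y in T M. 0 < evidence y \<longrightarrow> Q y)"
proof -
  have "distr P (T M) Y = density (T M) evidence"
  proof (rule measure_eqI)
    fix A assume "A \<in> sets (distr P (T M) Y)"
    then have A: "A \<in> sets (T M)" by simp
    have "emeasure (distr P (T M) Y) A = (\<integral>\<^sup>+\<omega>. indicator A (Y \<omega>) \<partial>P)"
      using A by (subst nn_integral_indicator[symmetric], simp, subst nn_integral_distr) auto
    also have "\<dots> = emeasure (density (T M) evidence) A"
      using A measurable_evidence by (simp add: nn_integral_evidence emeasure_density)
    finally show "emeasure (distr P (T M) Y) A = emeasure (density (T M) evidence) A" .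
  qed simp
  then have "(AE y in distr P (T M) Y. Q y) \<longleftrightarrow> (AE y in density (T M) evidence. Q y)"
    by (rule arg_cong[where f="\<lambda>N. almost_everywhere N Q"])
  then show ?thesis
    using Q by (simp add: AE_distr_iff AE_density[OF measurable_evidence])
qed

lemma AE_evidence: "AE \<omega> in P. 0 < evidence (Y \<omega>) \<and> evidence (Y \<omega>) < \<infinity>"
proof -
  note [measurable] = measurable_evidence
  have "(\<integral>\<^sup>+y. evidence y \<partial>T M) = 1"
    using nn_integral_evidence[of "\<lambda>_. 1"] by (simp add: emeasure_space_1)
  then have "AE y in T M. evidence y \<noteq> \<infinity>"
    using measurable_evidence by (intro nn_integral_PInf_AE) auto
  then show ?thesis
    by (subst AE_Y_iff) (auto elim!: eventually_mono simp: top.not_eq_extremum)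
qed

text \<open>Both sides, as functions of the value of \<open>Y\<close>, are densities of the measure
  \<open>A \<mapsto> E (h Z; Y \<in> A)\<close> with respect to the reference measure: the left one by importance sampling,
  the right one because \<open>Y\<close> has density \<open>evidence\<close> and \<open>Z\<close> given \<open>Y\<close> has law \<open>\<kappa> Y\<close>.\<close>
theorem nn_integral_weight:
  assumes \<kappa>: "reg_cond_dist P Z (V M) Y (T M) \<kappa>"
    and h: "h \<in> borel_measurable (V M)"
  shows "AE \<omega> in P. (\<integral>\<^sup>+z. weight M NT n f (Y \<omega>) z * h z \<partial>sim_measure \<gamma> M (Y \<omega>))
      = evidence (Y \<omega>) * (\<integral>\<^sup>+z. h z \<partial>\<kappa> (Y \<omega>))"
proof -
  interpret TM: sigma_finite_measure "T M" by (rule sigma_finite_T) simp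
  have \<kappa>m: "\<kappa> \<in> T M \<rightarrow>\<^sub>M prob_algebra (V M)" using \<kappa> by (simp add: reg_cond_dist_def)
  have ks: "sim_measure \<gamma> M \<in> T M \<rightarrow>\<^sub>M prob_algebra (V M)" by (intro measurable_sim_measure) auto
  note hs = measurable_compose[OF measurable_snd h]
  define \<phi> where "\<phi> y = (\<integral>\<^sup>+z. weight M NT n f y z * h z \<partial>sim_measure \<gamma> M y)" for y
  define \<psi> where "\<psi> y = (\<integral>\<^sup>+z. h z \<partial>\<kappa> y)" for y
  have wh: "(\<lambda>p. weight M NT n f (fst p) (snd p) * h (snd p)) \<in> borel_measurable (T M \<Otimes>\<^sub>M V M)"
    using measurable_weight hs by (intro borel_measurable_times_ennreal) (auto simp: case_prod_beta')
  have \<phi>: "\<phi> \<in> borel_measurable (T M)"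
    unfolding \<phi>_def
    by (rule nn_integral_measurable_subprob_algebra2[OF _ measurable_prob_algebraD[OF ks]])
       (use wh in \<open>simp add: case_prod_beta'\<close>)
  have \<psi>: "\<psi> \<in> borel_measurable (T M)"
    unfolding \<psi>_def
    by (rule nn_integral_measurable_subprob_algebra2[OF _ measurable_prob_algebraD[OF \<kappa>m]])
       (use hs in \<open>simp add: case_prod_beta'\<close>)
  have "density (T M) \<phi> = density (T M) (\<lambda>y. evidence y * \<psi> y)"
  proof (rule measure_eqI)
    fix A assume "A \<in> sets (density (T M) \<phi>)"
    then have A [measurable]: "A \<in> sets (T M)" by simp
    note [measurable] = \<phi> \<psi> measurable_evidence hs
    have Ah: "(\<lambda>p. h (snd p) * indicator A (fst p)) \<in> borel_measurable (T M \<Otimes>\<^sub>M V M)" by measurable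
    have \<phi>A: "\<phi> y * indicator A y = (\<integral>\<^sup>+z. weight M NT n f y z * (h z * indicator A y) \<partial>sim_measure \<gamma> M y)"
      if "y \<in> space (T M)" for y
    proof -
      have "(\<lambda>z. weight M NT n f y z * h z) \<in> borel_measurable (sim_measure \<gamma> M y)"
        using measurable_compose[OF measurable_Pair1'[OF that] wh] prob_algebra_kernel(2)[OF ks that]
        by (simp cong: measurable_cong_sets)
      then show ?thesis by (simp add: \<phi>_def nn_integral_multc mult.assoc[symmetric])
    qed
    have \<psi>A: "\<psi> y * indicator A y = (\<integral>\<^sup>+z. h z * indicator A y \<partial>\<kappa> y)" if "y \<in> space (T M)" for y
      using h prob_algebra_kernel(2)[OF \<kappa>m that]
      by (simp add: \<psi>_def nn_integral_multc cong: measurable_cong_sets)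
    have "emeasure (density (T M) \<phi>) A
        = (\<integral>\<^sup>+y. \<integral>\<^sup>+z. weight M NT n f y z * (h z * indicator A y) \<partial>sim_measure \<gamma> M y \<partial>T M)"
      by (simp add: emeasure_density \<phi>A cong: nn_integral_cong)
    also have "\<dots> = (\<integral>\<^sup>+\<omega>. h (Z \<omega>) * indicator A (Y \<omega>) \<partial>P)"
      using nn_integral_importance_sampling[OF Ah] by simp
    also have "\<dots> = (\<integral>\<^sup>+\<omega>. \<integral>\<^sup>+z. h z * indicator A (Y \<omega>) \<partial>\<kappa> (Y \<omega>) \<partial>P)"
      using nn_integral_reg_cond_dist[OF prob_space_axioms \<kappa> Ah] by simp
    also have "\<dots> = (\<integral>\<^sup>+\<omega>. \<psi> (Y \<omega>) * indicator A (Y \<omega>) \<partial>P)"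
      by (intro nn_integral_cong) (simp add: \<psi>A measurable_space[OF Y])
    also have "\<dots> = emeasure (density (T M) (\<lambda>y. evidence y * \<psi> y)) A"
      by (subst nn_integral_evidence) (auto simp: emeasure_density mult.assoc)
    finally show "emeasure (density (T M) \<phi>) A = emeasure (density (T M) (\<lambda>y. evidence y * \<psi> y)) A" .
  qed simp
  then have "AE y in T M. \<phi> y = evidence y * \<psi> y"
    using \<phi> \<psi> measurable_evidence by (intro TM.density_unique) auto
  moreover have "Measurable.pred (T M) (\<lambda>y. \<phi> y = evidence y * \<psi> y)"
    unfolding pred_def by (intro borel_measurable_eq borel_measurable_times_ennreal \<phi> \<psi> measurable_evidence)
  ultimately have "AE \<omega> in P. \<phi> (Y \<omega>) = evidence (Y \<omega>) * \<psi> (Y \<omega>)"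
    by (subst AE_Y_iff) (auto elim: eventually_mono)
  then show ?thesis by (simp add: \<phi>_def \<psi>_def)
qed

end

section \<open>Self-normalized importance sampling\<close>

text \<open>A measure with the values of a weighted empirical measure is the image under \<open>x\<close> of the normalized
  weights on the index set.\<close>
lemma integral_weighted_empirical:
  fixes h :: "'x \<Rightarrow> real" and p :: "'i \<Rightarrow> real"
  assumes I: "finite I" and sets: "sets \<mu> = sets N" and x: "\<And>k. k \<in> I \<Longrightarrow> x k \<in> space N"
    and p: "\<And>k. k \<in> I \<Longrightarrow> 0 \<le> p k" and pos: "0 < (\<Sum>k\<in>I. p k)"
    and em: "\<And>A. A \<in> sets N \<Longrightarrow> emeasure \<mu> A
        = (\<Sum>k\<in>I. ennreal (p k) * emeasure (return N (x k)) A) / ennreal (\<Sum>k\<in>I. p k)"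
    and h: "h \<in> borel_measurable N"
  shows "(\<integral>z. h z \<partial>\<mu>) = (\<Sum>k\<in>I. p k * h (x k)) / (\<Sum>k\<in>I. p k)"
proof -
  let ?S = "\<Sum>k\<in>I. p k"
  let ?R = "point_measure I (\<lambda>k. ennreal (p k / ?S))"
  have x': "x \<in> ?R \<rightarrow>\<^sub>M N" using x by (auto simp: measurable_point_measure_eq1)
  have "\<mu> = distr ?R N x"
  proof (rule measure_eqI)
    fix A assume "A \<in> sets \<mu>"
    then have A: "A \<in> sets N" using sets by simp
    have "emeasure \<mu> A = ennreal ((\<Sum>k\<in>I. p k * indicator A (x k)) / ?S)"
      using A p pos by (simp add: em ennreal_indicator[symmetric] ennreal_mult''[symmetric] sum_nonneg divide_ennreal)
    also have "(\<Sum>k\<in>I. p k * indicator A (x k)) / ?S = (\<Sum>k\<in>x -` A \<inter> I. p k / ?S)"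
      using I by (simp add: sum_divide_distrib indicator_def sum.If_cases sum.inter_filter[symmetric] vimage_def Int_def conj_commute
          if_distrib[where f="\<lambda>a. _ * a"] cong: if_cong)
    also have "ennreal \<dots> = (\<Sum>k\<in>x -` A \<inter> I. ennreal (p k / ?S))"
      using p pos by (intro sum_ennreal[symmetric]) auto
    also have "\<dots> = emeasure (distr ?R N x) A"
      using A I x' by (simp add: emeasure_distr space_point_measure emeasure_point_measure_finite)
    finally show "emeasure \<mu> A = emeasure (distr ?R N x) A" .
  qed (simp add: sets)
  then have "(\<integral>z. h z \<partial>\<mu>) = (\<integral>k. h (x k) \<partial>?R)"
    using x' h by (simp add: integral_distr)
  also have "\<dots> = (\<Sum>k\<in>I. p k * h (x k)) / ?S"
    using I p pos by (subst lebesgue_integral_point_measure_finite) (auto simp: sum_divide_distrib)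
  finally show ?thesis .
qed

context simulation_model
begin

text \<open>The identity for extended nonnegative integrals, in real numbers: since \<open>evidence (Y \<omega>)\<close> is finite,
  so is the weight almost everywhere, and \<open>enn2real\<close> loses nothing.\<close>
lemma
  assumes \<kappa>: "reg_cond_dist P Z (V M) Y (T M) \<kappa>"
    and h: "h \<in> borel_measurable (V M)" and h0: "\<And>z. 0 \<le> h z" and hc: "\<And>z. h z \<le> (c::real)"
  shows AE_integrable_weight: "AE \<omega> in P. integrable (sim_measure \<gamma> M (Y \<omega>)) (\<lambda>z. enn2real (weight M NT n f (Y \<omega>) z) * h z)"
    and AE_integral_weight: "AE \<omega> in P. (\<integral>z. enn2real (weight M NT n f (Y \<omega>) z) * h z \<partial>sim_measure \<gamma> M (Y \<omega>))
      = enn2real (evidence (Y \<omega>)) * (\<integral>z. h z \<partial>\<kappa> (Y \<omega>))"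
    and AE_weight_finite: "AE \<omega> in P. AE z in sim_measure \<gamma> M (Y \<omega>). weight M NT n f (Y \<omega>) z < \<infinity>"
proof -
  have \<kappa>m: "\<kappa> \<in> T M \<rightarrow>\<^sub>M prob_algebra (V M)" using \<kappa> by (simp add: reg_cond_dist_def)
  have ks: "sim_measure \<gamma> M \<in> T M \<rightarrow>\<^sub>M prob_algebra (V M)" by (intro measurable_sim_measure) auto
  have "AE \<omega> in P. integrable (sim_measure \<gamma> M (Y \<omega>)) (\<lambda>z. enn2real (weight M NT n f (Y \<omega>) z) * h z)
      \<and> (\<integral>z. enn2real (weight M NT n f (Y \<omega>) z) * h z \<partial>sim_measure \<gamma> M (Y \<omega>))
        = enn2real (evidence (Y \<omega>)) * (\<integral>z. h z \<partial>\<kappa> (Y \<omega>))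
      \<and> (AE z in sim_measure \<gamma> M (Y \<omega>). weight M NT n f (Y \<omega>) z < \<infinity>)"
    using AE_evidence nn_integral_weight[OF \<kappa>, of "\<lambda>_. 1", OF borel_measurable_const]
      nn_integral_weight[OF \<kappa> measurable_compose[OF h measurable_ennreal]] AE_space
  proof eventually_elim
    case (elim \<omega>)
    have y: "Y \<omega> \<in> space (T M)" using measurable_space[OF Y elim(4)] .
    note sims = prob_algebra_kernel[OF ks y] and ks' = prob_algebra_kernel[OF \<kappa>m y]
    let ?\<mu> = "sim_measure \<gamma> M (Y \<omega>)" and ?w = "weight M NT n f (Y \<omega>)"
    interpret K: prob_space "\<kappa> (Y \<omega>)" by (rule ks'(1))
    have w: "?w \<in> borel_measurable ?\<mu>"
      using measurable_compose[OF measurable_Pair1'[OF y] measurable_weight] by (simp add: measurable_cong_sets[OF sims(2) refl])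
    have h\<mu>: "h \<in> borel_measurable ?\<mu>" and h\<kappa>: "h \<in> borel_measurable (\<kappa> (Y \<omega>))"
      using h by (simp_all add: measurable_cong_sets[OF sims(2) refl] measurable_cong_sets[OF ks'(2) refl])
    have "(\<integral>\<^sup>+z. ?w z \<partial>?\<mu>) \<noteq> \<infinity>"
      using elim(1,2) K.emeasure_space_1 by (auto simp: top.not_eq_extremum)
    then have fin: "AE z in ?\<mu>. ?w z \<noteq> \<infinity>" by (rule nn_integral_PInf_AE[OF w])
    have inth: "integrable (\<kappa> (Y \<omega>)) h"
      using h0 hc by (intro K.integrable_const_bound[where B=c] h\<kappa>) auto
    have "(\<integral>\<^sup>+z. ennreal (enn2real (?w z) * h z) \<partial>?\<mu>) = (\<integral>\<^sup>+z. ?w z * ennreal (h z) \<partial>?\<mu>)"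
      using fin by (intro nn_integral_cong_AE) (auto simp: ennreal_mult h0 top.not_eq_extremum elim!: eventually_mono)
    also have "\<dots> = evidence (Y \<omega>) * ennreal (\<integral>z. h z \<partial>\<kappa> (Y \<omega>))"
      using elim(3) h0 by (simp add: nn_integral_eq_integral[OF inth])
    also have "\<dots> = ennreal (enn2real (evidence (Y \<omega>)) * (\<integral>z. h z \<partial>\<kappa> (Y \<omega>)))"
      using elim(1) by (simp add: ennreal_mult h0)
    finally have eq: "(\<integral>\<^sup>+z. ennreal (enn2real (?w z) * h z) \<partial>?\<mu>) = ennreal (enn2real (evidence (Y \<omega>)) * (\<integral>z. h z \<partial>\<kappa> (Y \<omega>)))" .
    have meas: "(\<lambda>z. enn2real (?w z) * h z) \<in> borel_measurable ?\<mu>" using w h\<mu> by measurable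
    have "integrable ?\<mu> (\<lambda>z. enn2real (?w z) * h z)"
      using eq h0 by (intro integrableI_nonneg meas) auto
    moreover have "(\<integral>z. enn2real (?w z) * h z \<partial>?\<mu>) = enn2real (evidence (Y \<omega>)) * (\<integral>z. h z \<partial>\<kappa> (Y \<omega>))"
      using eq h0 by (subst integral_eq_nn_integral[OF meas]) auto
    ultimately show ?case using fin by (simp add: top.not_eq_extremum)
  qed
  then show "AE \<omega> in P. integrable (sim_measure \<gamma> M (Y \<omega>)) (\<lambda>z. enn2real (weight M NT n f (Y \<omega>) z) * h z)"
    "AE \<omega> in P. (\<integral>z. enn2real (weight M NT n f (Y \<omega>) z) * h z \<partial>sim_measure \<gamma> M (Y \<omega>))
      = enn2real (evidence (Y \<omega>)) * (\<integral>z. h z \<partial>\<kappa> (Y \<omega>))"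
    "AE \<omega> in P. AE z in sim_measure \<gamma> M (Y \<omega>). weight M NT n f (Y \<omega>) z < \<infinity>"
    by (auto elim: eventually_mono)
qed

lemma AE_weighted_average:
  assumes \<kappa>: "reg_cond_dist P Z (V M) Y (T M) \<kappa>"
    and Zs: "cond_iid P Zs (V M) Y (T M) (sim_measure \<gamma> M)"
    and h: "h \<in> borel_measurable (V M)" "\<And>z. 0 \<le> h z" "\<And>z. h z \<le> (c::real)"
  shows "AE \<omega> in P. (\<lambda>K. (\<Sum>k<K. enn2real (weight M NT n f (Y \<omega>) (Zs (Suc k) \<omega>)) * h (Zs (Suc k) \<omega>)) / K)
    \<longlonglongrightarrow> enn2real (evidence (Y \<omega>)) * (\<integral>z. h z \<partial>\<kappa> (Y \<omega>))"
proof -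
  let ?g = "\<lambda>p. enn2real (weight M NT n f (fst p) (snd p)) * h (snd p)"
  have [measurable]: "(\<lambda>p. weight M NT n f (fst p) (snd p)) \<in> borel_measurable (T M \<Otimes>\<^sub>M V M)"
    using measurable_weight by (simp add: case_prod_beta')
  note h(1) [measurable]
  have "?g \<in> borel_measurable (T M \<Otimes>\<^sub>M V M)"
    by measurable
  from conditional_strong_law[OF prob_space_axioms Zs this] AE_integrable_weight[OF \<kappa> h]
  have "AE \<omega> in P. (\<lambda>K. (\<Sum>k<K. enn2real (weight M NT n f (Y \<omega>) (Zs (Suc k) \<omega>)) * h (Zs (Suc k) \<omega>)) / K)
      \<longlonglongrightarrow> (\<integral>z. enn2real (weight M NT n f (Y \<omega>) z) * h z \<partial>sim_measure \<gamma> M (Y \<omega>))"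
    by simp
  with AE_integral_weight[OF \<kappa> h] show ?thesis
    by eventually_elim simp
qed

lemma AE_weights_finite:
  assumes \<kappa>: "reg_cond_dist P Z (V M) Y (T M) \<kappa>"
    and Zs: "cond_iid P Zs (V M) Y (T M) (sim_measure \<gamma> M)"
  shows "AE \<omega> in P. \<forall>k. weight M NT n f (Y \<omega>) (Zs (Suc k) \<omega>) < \<infinity>"
proof -
  have ks: "sim_measure \<gamma> M \<in> T M \<rightarrow>\<^sub>M prob_algebra (V M)" by (intro measurable_sim_measure) auto
  let ?Q = "\<lambda>p. \<forall>k::nat. weight M NT n f (fst p) (snd p k) < \<infinity>"
  have "AE \<omega> in P. ?Q (Y \<omega>, \<lambda>k. Zs (Suc k) \<omega>)"
  proof (rule AE_cond_iid[OF prob_space_axioms Zs, of ?Q])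
    have [measurable]: "(\<lambda>p. weight M NT n f (fst p) (snd p k)) \<in> borel_measurable (T M \<Otimes>\<^sub>M PiM UNIV (\<lambda>_::nat. V M))" for k
      using measurable_compose[OF _ measurable_weight, of "\<lambda>p. (fst p, snd p k)" "T M \<Otimes>\<^sub>M PiM UNIV (\<lambda>_::nat. V M)"]
      by simp
    show "Measurable.pred (T M \<Otimes>\<^sub>M PiM UNIV (\<lambda>_::nat. V M)) ?Q" by measurable
    show "AE \<omega> in P. AE \<zeta> in PiM UNIV (\<lambda>_. sim_measure \<gamma> M (Y \<omega>)). ?Q (Y \<omega>, \<zeta>)"
      using AE_weight_finite[OF \<kappa>, of "\<lambda>_. 0" 0, simplified] AE_space
    proof eventually_elim
      case (elim \<omega>)
      have p: "prob_space (sim_measure \<gamma> M (Y \<omega>))"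
        by (rule prob_algebra_kernel(1)[OF ks measurable_space[OF Y elim(2)]])
      have "AE \<zeta> in PiM UNIV (\<lambda>_::nat. sim_measure \<gamma> M (Y \<omega>)). weight M NT n f (Y \<omega>) (\<zeta> k) < \<infinity>" for k
        by (rule AE_PiM_component[OF p]) (use elim(1) in simp_all)
      then show ?case by (simp add: AE_all_countable)
    qed
  qed
  then show ?thesis by simp
qed

end

theorem theorem3p6:
  fixes P :: "'w measure"
    and NT :: "'t measure"
    and M :: nat
    and Z :: "'w \<Rightarrow> nat \<Rightarrow> 's::polish_space"
    and Y :: "'w \<Rightarrow> nat \<Rightarrow> 't"
    and n :: "nat \<Rightarrow> (nat \<Rightarrow> 's) measure"
    and f :: "nat \<Rightarrow> (nat \<Rightarrow> 't) \<times> (nat \<Rightarrow> 's) \<Rightarrow> ennreal"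
    and \<gamma> :: "nat \<Rightarrow> (nat \<Rightarrow> 't) \<times> (nat \<Rightarrow> 's) \<Rightarrow> 's measure"
    and \<kappa> :: "(nat \<Rightarrow> 't) \<Rightarrow> (nat \<Rightarrow> 's) measure"
    and Zs :: "nat \<Rightarrow> 'w \<Rightarrow> nat \<Rightarrow> 's"
    and W :: "nat \<Rightarrow> 'w \<Rightarrow> ennreal"
    and Zt :: "nat \<Rightarrow> 'w \<Rightarrow> nat \<Rightarrow> 's"
    and \<nu> :: "nat \<Rightarrow> (nat \<Rightarrow> nat \<Rightarrow> 's) \<times> (nat \<Rightarrow> 't) \<Rightarrow> (nat \<Rightarrow> 's) measure"
  assumes "prob_space P" and "M \<ge> 1"
    and "Z \<in> measurable P (vec_measure borel M)"
    and "Y \<in> measurable P (vec_measure NT M)"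
    and "sigma_finite_measure NT"
    and "\<And>m. m \<in> {1..M} \<Longrightarrow> sigma_finite_measure (n m) \<and> sets (n m) = sets (vec_measure borel m)"
    and "\<And>m. m \<in> {1..M} \<Longrightarrow>
      absolutely_continuous (vec_measure NT M \<Otimes>\<^sub>M n m)
        (distr P (vec_measure NT M \<Otimes>\<^sub>M n m) (\<lambda>\<omega>. (Y \<omega>, restrict (Z \<omega>) {1..m})))"
    and "\<And>m. m \<in> {1..M} \<Longrightarrow>
      distributed P (vec_measure NT M \<Otimes>\<^sub>M n m) (\<lambda>\<omega>. (Y \<omega>, restrict (Z \<omega>) {1..m})) (f m)"
    (* choice of the version of f m *)
    and "\<And>m y z. m \<in> {1..M} \<Longrightarrow> y \<in> space (vec_measure NT M) \<Longrightarrow> z \<in> space (n m) \<Longrightarrow> f m (y, z) < \<infinity>"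
    and "\<And>m J y z. m \<in> {1..M} \<Longrightarrow> J \<subseteq> {1..M} \<Longrightarrow>
      y \<in> space (vec_measure NT M) \<Longrightarrow> z \<in> space (n m) \<Longrightarrow>
      marg_yz M NT (f m) J y z = 0 \<or> marg_y M NT (n m) (f m) J y = 0 \<Longrightarrow> f m (y, z) = 0"
    (* simulation kernels: conditional laws of Z_m given (Y_1..Y_m, Z_1..Z_(m-1)) *)
    and "\<And>m. m \<in> {1..M} \<Longrightarrow>
      reg_cond_dist P (\<lambda>\<omega>. Z \<omega> m) borel
        (\<lambda>\<omega>. (restrict (Y \<omega>) {1..m}, restrict (Z \<omega>) {1..m-1}))
        (vec_measure NT m \<Otimes>\<^sub>M vec_measure borel (m-1)) (\<gamma> m)"
    and "reg_cond_dist P Z (vec_measure borel M) Y (vec_measure NT M) \<kappa>"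
    and "cond_iid P Zs (vec_measure borel M) Y (vec_measure NT M) (sim_measure \<gamma> M)"
    and "\<And>k \<omega>. W k \<omega> = weight M NT n f (Y \<omega>) (Zs k \<omega>)"
    and "\<And>K. K \<ge> 1 \<Longrightarrow>
      reg_cond_dist P (Zt K) (vec_measure borel M)
        (\<lambda>\<omega>. (\<lambda>k\<in>{1..K}. Zs k \<omega>, Y \<omega>))
        (vec_measure (vec_measure borel M) K \<Otimes>\<^sub>M vec_measure NT M) (\<nu> K)"
    and "\<And>K. K \<ge> 1 \<Longrightarrow>
      AE \<omega> in P. (\<Sum>k=1..K. W k \<omega>) > 0 \<longrightarrow>
        (\<forall>A\<in>sets (vec_measure borel M).
          emeasure (\<nu> K (\<lambda>k\<in>{1..K}. Zs k \<omega>, Y \<omega>)) A =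
          (\<Sum>k=1..K. W k \<omega> * emeasure (return (vec_measure borel M) (Zs k \<omega>)) A) / (\<Sum>k=1..K. W k \<omega>))"
    and "(\<integral>\<^sup>+y. (marg_y M NT (n M) (f M) {1..M} y)\<^sup>2 \<partial>vec_measure NT M) < \<infinity>"
  shows "AE \<omega> in P.
    weakly_converges (product_topology (\<lambda>_. euclidean) {1..M})
      (\<lambda>K. \<nu> K (\<lambda>k\<in>{1..K}. Zs k \<omega>, Y \<omega>)) (\<kappa> (Y \<omega>))"
proof -
  let ?V = "vec_measure (borel :: 's measure) M" and ?T = "vec_measure NT M"
  note \<kappa> = assms(12) and Zs = assms(13) and W = assms(14) and \<nu> = assms(15) and \<nu>_eq = assms(16)
  interpret simulation_model P NT M Z Y n f \<gamma>
    by (intro simulation_model.intro simulation_model_axioms.intro) (use assms in auto)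
  have \<kappa>m: "\<kappa> \<in> ?T \<rightarrow>\<^sub>M prob_algebra ?V" using \<kappa> by (simp add: reg_cond_dist_def)
  have Zsm: "\<And>k. Zs (Suc k) \<in> P \<rightarrow>\<^sub>M ?V" using Zs by (simp add: cond_iid_def)
  define p where "p k \<omega> = enn2real (weight M NT n f (Y \<omega>) (Zs (Suc k) \<omega>))" for k \<omega>
  have avg: "AE \<omega> in P. (\<lambda>K. (\<Sum>k<K. p k \<omega> * h (Zs (Suc k) \<omega>)) / K)
      \<longlonglongrightarrow> enn2real (evidence (Y \<omega>)) * (\<integral>z. h z \<partial>\<kappa> (Y \<omega>))"
    if "h \<in> borel_measurable ?V" "\<And>z. 0 \<le> h z" "\<exists>c. \<forall>z. h z \<le> (c::real)" for h
  proof -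
    obtain c where c: "\<And>z. h z \<le> c" using \<open>\<exists>c. \<forall>z. h z \<le> c\<close> by blast
    show ?thesis
      using AE_weighted_average[OF \<kappa> Zs that(1,2) c] by (simp add: p_def)
  qed
  have avg_1: "AE \<omega> in P. (\<lambda>K. (\<Sum>k<K. p k \<omega> * 1) / K)
      \<longlonglongrightarrow> enn2real (evidence (Y \<omega>)) * (\<integral>z. 1 \<partial>\<kappa> (Y \<omega>))"
    by (rule avg) auto
  \<comment> \<open>The countably many test functions share one exceptional null set.\<close>
  have avg_test: "AE \<omega> in P. \<forall>h \<in> test_functions M. (\<lambda>K. (\<Sum>k<K. p k \<omega> * h (Zs (Suc k) \<omega>)) / K)
      \<longlonglongrightarrow> enn2real (evidence (Y \<omega>)) * (\<integral>z. h z \<partial>\<kappa> (Y \<omega>))"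
    unfolding AE_ball_countable[OF countable_test_functions]
    by (intro ballI avg test_functions_bounded_measurable)
  have \<nu>_eq': "AE \<omega> in P. \<forall>K\<in>{1..}. (\<Sum>k=1..K. W k \<omega>) > 0 \<longrightarrow>
        (\<forall>A\<in>sets ?V.
          emeasure (\<nu> K (\<lambda>k\<in>{1..K}. Zs k \<omega>, Y \<omega>)) A =
          (\<Sum>k=1..K. W k \<omega> * emeasure (return ?V (Zs k \<omega>)) A) / (\<Sum>k=1..K. W k \<omega>))"
    using \<nu>_eq by (subst AE_ball_countable) auto
  from avg_1 avg_test \<nu>_eq' AE_evidence AE_weights_finite[OF \<kappa> Zs] AE_space
  show ?thesis
  proof eventually_elim
    case (elim \<omega>)
    let ?\<mu> = "\<lambda>K. \<nu> K (\<lambda>k\<in>{1..K}. Zs k \<omega>, Y \<omega>)"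
    define e where "e = enn2real (evidence (Y \<omega>))"
    have e: "0 < e" using elim(4) by (simp add: e_def enn2real_positive_iff)
    note K = prob_algebra_kernel[OF \<kappa>m measurable_space[OF Y elim(6)]]
    interpret K: prob_space "\<kappa> (Y \<omega>)" by (rule K(1))
    have lim1: "(\<lambda>K. (\<Sum>k<K. p k \<omega>) / K) \<longlonglongrightarrow> e"
      using elim(1) by (simp add: e_def K.prob_space)
    have pW: "W (Suc k) \<omega> = ennreal (p k \<omega>)" for k
      using elim(5) by (simp add: W p_def)
    have p0: "0 \<le> p k \<omega>" for k by (simp add: p_def)
    have sumW: "(\<Sum>k=1..K. W k \<omega>) = ennreal (\<Sum>k<K. p k \<omega>)" for K
      using p0 by (simp add: sum.atLeast1_atMost_eq One_nat_def pW)
    \<comment> \<open>The normalizing sums become positive because their averages tend to \<open>e > 0\<close>.\<close>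
    have ev: "eventually (\<lambda>K. K \<ge> 1 \<and> 0 < (\<Sum>k<K. p k \<omega>)) sequentially"
      using order_tendstoD(1)[OF lim1 e] eventually_ge_at_top[of 1]
      by eventually_elim (auto simp: zero_less_divide_iff)
    \<comment> \<open>The value of \<open>\<nu> 0\<close> is arbitrary, hence the restriction to \<open>K \<ge> 1\<close>.\<close>
    have kern: "prob_space (?\<mu> K)" "sets (?\<mu> K) = sets ?V" if "K \<ge> 1" for K
    proof -
      have "(\<lambda>\<omega>. (\<lambda>k\<in>{1..K}. Zs k \<omega>, Y \<omega>)) \<in> P \<rightarrow>\<^sub>M vec_measure ?V K \<Otimes>\<^sub>M ?T"
        and \<nu>m: "\<nu> K \<in> vec_measure ?V K \<Otimes>\<^sub>M ?T \<rightarrow>\<^sub>M prob_algebra ?V"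
        using \<nu>[OF that] by (auto simp: reg_cond_dist_def)
      from prob_algebra_kernel[OF \<nu>m measurable_space[OF this(1) elim(6)]]
      show "prob_space (?\<mu> K)" "sets (?\<mu> K) = sets ?V" by auto
    qed
    have int: "(\<integral>z. h z \<partial>?\<mu> K) = (\<Sum>k<K. p k \<omega> * h (Zs (Suc k) \<omega>)) / (\<Sum>k<K. p k \<omega>)"
      if h: "h \<in> borel_measurable ?V" and K: "K \<ge> 1 \<and> 0 < (\<Sum>k<K. p k \<omega>)" for h :: "_ \<Rightarrow> real" and K
    proof (rule integral_weighted_empirical[OF _ kern(2) _ p0 _ _ h])
      fix A assume A: "A \<in> sets ?V"
      have "0 < (\<Sum>k=1..K. W k \<omega>)" using K by (simp add: sumW)
      with elim(3) K A have "emeasure (?\<mu> K) A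
          = (\<Sum>k=1..K. W k \<omega> * emeasure (return ?V (Zs k \<omega>)) A) / (\<Sum>k=1..K. W k \<omega>)" by auto
      then show "emeasure (?\<mu> K) A = (\<Sum>k<K. ennreal (p k \<omega>) * emeasure (return ?V (Zs (Suc k) \<omega>)) A)
          / ennreal (\<Sum>k<K. p k \<omega>)"
        unfolding sumW by (simp add: sum.atLeast1_atMost_eq One_nat_def pW)
    qed (use K measurable_space[OF Zsm elim(6)] in auto)
    show ?case
    proof (rule weakly_converges_if_test_functions[OF _ K(1,2)])
      show "eventually (\<lambda>K. prob_space (?\<mu> K) \<and> sets (?\<mu> K) = sets ?V) sequentially"
        using eventually_ge_at_top[of 1] by eventually_elim (simp add: kern)
      fix h :: "(nat \<Rightarrow> 's) \<Rightarrow> real" assume h: "h \<in> test_functions M"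
      have "(\<lambda>K. ((\<Sum>k<K. p k \<omega> * h (Zs (Suc k) \<omega>)) / K) / ((\<Sum>k<K. p k \<omega>) / K)) \<longlonglongrightarrow> (e * (\<integral>z. h z \<partial>\<kappa> (Y \<omega>))) / e"
        using elim(2) h e by (intro tendsto_divide lim1) (auto simp: e_def)
      also have "(e * (\<integral>z. h z \<partial>\<kappa> (Y \<omega>))) / e = (\<integral>z. h z \<partial>\<kappa> (Y \<omega>))" using e by simp
      finally show "(\<lambda>K. \<integral>z. h z \<partial>?\<mu> K) \<longlonglongrightarrow> (\<integral>z. h z \<partial>\<kappa> (Y \<omega>))"
      proof (rule Lim_transform_eventually)
        show "eventually (\<lambda>K. ((\<Sum>k<K. p k \<omega> * h (Zs (Suc k) \<omega>)) / K) / ((\<Sum>k<K. p k \<omega>) / K) = (\<integral>z. h z \<partial>?\<mu> K)) sequentially"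
          using ev by eventually_elim (simp add: int test_functions_bounded_measurable(1)[OF h])
      qed
    qed
  qed
qed

end
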